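(* For any ring $R$, let $f:\mathcal{U}(R)\to\mathcal{V}(R)$ be the inclusion map. Then the induced group homomorphism $G(f):G(\mathcal{U}(R))\to\mathcal{K}_0(R)$ is injective.
   Context: Rings are associative with unit. For a ring $R$, $\mathcal{V}(R)$ is the additive commutative monoid of isomorphism classes of finitely generated projective right $R$-modules, with addition given by direct sum, and $\mathcal{U}(R)$ is the cyclic submonoid of $\mathcal{V}(R)$ generated by $[R]$. For a commutative semigroup $S$, $G(S)$ denotes its Grothendieck group (the universal abelian group receiving a semigroup homomorphism from $S$); $G$ is functorial, and $G(f)$ is the group homomorphism induced by a semigroup homomorphism $f$. By definition $\mathcal{K}_0(R)=G(\mathcal{V}(R))$. *)

theory Defs
  imports "HOL-Algebra.Module"
begin

section \<open>Right modules over an associative unital ring\<close>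

text \<open>
  The library's \<^locale>\<open>module\<close> requires a commutative ring.  As in the library's module record,
  the fields for multiplication and one inherited from the ring record play no role.
\<close>

record ('a, 'm) rmodule = "'m ring" +
  ract :: "'m \<Rightarrow> 'a \<Rightarrow> 'm" (infixl "\<triangleleft>\<index>" 70)

locale right_module = R?: ring R + M?: abelian_group M
  for R :: "('a, 'r) ring_scheme" (structure) and M :: "('a, 'm, 'x) rmodule_scheme" (structure) +
  assumes ract_closed [simp, intro]:
      "\<lbrakk>x \<in> carrier M; a \<in> carrier R\<rbrakk> \<Longrightarrow> x \<triangleleft>\<^bsub>M\<^esub> a \<in> carrier M"
    and ract_add_right:
      "\<lbrakk>x \<in> carrier M; a \<in> carrier R; b \<in> carrier R\<rbrakk> \<Longrightarrow>
        x \<triangleleft>\<^bsub>M\<^esub> (a \<oplus>\<^bsub>R\<^esub> b) = x \<triangleleft>\<^bsub>M\<^esub> a \<oplus>\<^bsub>M\<^esub> x \<triangleleft>\<^bsub>M\<^esub> b"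
    and ract_add_left:
      "\<lbrakk>x \<in> carrier M; y \<in> carrier M; a \<in> carrier R\<rbrakk> \<Longrightarrow>
        (x \<oplus>\<^bsub>M\<^esub> y) \<triangleleft>\<^bsub>M\<^esub> a = x \<triangleleft>\<^bsub>M\<^esub> a \<oplus>\<^bsub>M\<^esub> y \<triangleleft>\<^bsub>M\<^esub> a"
    and ract_assoc:
      "\<lbrakk>x \<in> carrier M; a \<in> carrier R; b \<in> carrier R\<rbrakk> \<Longrightarrow>
        x \<triangleleft>\<^bsub>M\<^esub> (a \<otimes>\<^bsub>R\<^esub> b) = (x \<triangleleft>\<^bsub>M\<^esub> a) \<triangleleft>\<^bsub>M\<^esub> b"
    and ract_one [simp]:
      "x \<in> carrier M \<Longrightarrow> x \<triangleleft>\<^bsub>M\<^esub> \<one>\<^bsub>R\<^esub> = x"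

definition rmod_hom ::
  "('a, 'r) ring_scheme \<Rightarrow> ('a, 'm, 'x) rmodule_scheme \<Rightarrow> ('a, 'n, 'y) rmodule_scheme \<Rightarrow> ('m \<Rightarrow> 'n) set"
  where "rmod_hom R M N = {f \<in> carrier M \<rightarrow> carrier N.
    (\<forall>x\<in>carrier M. \<forall>y\<in>carrier M. f (x \<oplus>\<^bsub>M\<^esub> y) = f x \<oplus>\<^bsub>N\<^esub> f y) \<and>
    (\<forall>x\<in>carrier M. \<forall>a\<in>carrier R. f (x \<triangleleft>\<^bsub>M\<^esub> a) = f x \<triangleleft>\<^bsub>N\<^esub> a)}"

definition rmod_iso ::
  "('a, 'r) ring_scheme \<Rightarrow> ('a, 'm, 'x) rmodule_scheme \<Rightarrow> ('a, 'n, 'y) rmodule_scheme \<Rightarrow> bool"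
  where "rmod_iso R M N \<longleftrightarrow> (\<exists>f\<in>rmod_hom R M N. bij_betw f (carrier M) (carrier N))"

definition regular_rmodule :: "('a, 'r) ring_scheme \<Rightarrow> ('a, 'a) rmodule"
  where "regular_rmodule R =
    \<lparr>carrier = carrier R, mult = mult R, one = one R, zero = zero R, add = add R,
     ract = (\<lambda>x a. x \<otimes>\<^bsub>R\<^esub> a)\<rparr>"

definition zero_rmodule :: "('a, unit) rmodule"
  where "zero_rmodule =
    \<lparr>carrier = {()}, mult = (\<lambda>_ _. ()), one = (), zero = (), add = (\<lambda>_ _. ()), ract = (\<lambda>_ _. ())\<rparr>"

definition direct_sum ::
  "('a, 'm, 'x) rmodule_scheme \<Rightarrow> ('a, 'n, 'y) rmodule_scheme \<Rightarrow> ('a, 'm \<times> 'n) rmodule"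
  where "direct_sum M N =
    \<lparr>carrier = carrier M \<times> carrier N,
     mult = undefined, one = undefined,
     zero = (\<zero>\<^bsub>M\<^esub>, \<zero>\<^bsub>N\<^esub>),
     add = (\<lambda>(x, y) (x', y'). (x \<oplus>\<^bsub>M\<^esub> x', y \<oplus>\<^bsub>N\<^esub> y')),
     ract = (\<lambda>(x, y) a. (x \<triangleleft>\<^bsub>M\<^esub> a, y \<triangleleft>\<^bsub>N\<^esub> a))\<rparr>"

definition fin_gen :: "('a, 'r) ring_scheme \<Rightarrow> ('a, 'm, 'x) rmodule_scheme \<Rightarrow> bool"
  where "fin_gen R M \<longleftrightarrow> (\<exists>n::nat. \<exists>x \<in> {..<n} \<rightarrow> carrier M.
    \<forall>m\<in>carrier M. \<exists>c \<in> {..<n} \<rightarrow> carrier R. m = (\<Oplus>\<^bsub>M\<^esub> i\<in>{..<n}. x i \<triangleleft>\<^bsub>M\<^esub> c i))"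

text \<open>
  HOL cannot quantify over types inside a definition, so the modules \<open>B\<close> and \<open>C\<close> in the lifting
  property have carriers in the type \<^typ>\<open>nat \<Rightarrow> 'a\<close>.  This loses nothing for the finitely generated
  modules considered below: every finitely generated module is isomorphic to one with carrier in
  that type (\<open>ex_small_copy\<close>), and every finitely generated module satisfying this definition has
  the lifting property against modules with carriers in arbitrary types (\<open>fg_projective_lift\<close>).
\<close>

definition projective :: "('a, 'r) ring_scheme \<Rightarrow> ('a, 'm, 'x) rmodule_scheme \<Rightarrow> bool"
  where "projective R P \<longleftrightarrow>
    (\<forall>(B :: ('a, nat \<Rightarrow> 'a) rmodule) (C :: ('a, nat \<Rightarrow> 'a) rmodule) g h.
      right_module R B \<longrightarrow> right_module R C \<longrightarrow>
      g \<in> rmod_hom R B C \<longrightarrow> g ` carrier B = carrier C \<longrightarrow> h \<in> rmod_hom R P C \<longrightarrow>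
      (\<exists>k\<in>rmod_hom R P B. \<forall>p\<in>carrier P. g (k p) = h p))"

definition fg_projective :: "('a, 'r) ring_scheme \<Rightarrow> ('a, 'm, 'x) rmodule_scheme \<Rightarrow> bool"
  where "fg_projective R P \<longleftrightarrow> right_module R P \<and> fin_gen R P \<and> projective R P"

section \<open>The monoids of isomorphism classes\<close>

text \<open>
  The class of a module \<open>M\<close>, whose carrier may have any element type, consists of its copies with
  carrier in \<^typ>\<open>nat \<Rightarrow> 'a\<close>.
\<close>

definition iso_class ::
  "('a, 'r) ring_scheme \<Rightarrow> ('a, 'm, 'x) rmodule_scheme \<Rightarrow> ('a, nat \<Rightarrow> 'a) rmodule set"
  where "iso_class R M = {P. fg_projective R P \<and> rmod_iso R P M}"

definition VR :: "('a, 'r) ring_scheme \<Rightarrow> ('a, nat \<Rightarrow> 'a) rmodule set monoid"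
  where "VR R =
    \<lparr>carrier = {iso_class R P |P :: ('a, nat \<Rightarrow> 'a) rmodule. fg_projective R P},
     mult = (\<lambda>X Y. {M. fg_projective R M \<and> (\<exists>P\<in>X. \<exists>Q\<in>Y. rmod_iso R M (direct_sum P Q))}),
     one = iso_class R (zero_rmodule :: ('a, unit) rmodule)\<rparr>"

definition cyclic_submonoid :: "('s, 'x) monoid_scheme \<Rightarrow> 's \<Rightarrow> ('s, 'x) monoid_scheme"
  where "cyclic_submonoid S x = S\<lparr>carrier := range (\<lambda>n::nat. x [^]\<^bsub>S\<^esub> n)\<rparr>"

definition UR :: "('a, 'r) ring_scheme \<Rightarrow> ('a, nat \<Rightarrow> 'a) rmodule set monoid"
  where "UR R = cyclic_submonoid (VR R) (iso_class R (regular_rmodule R))"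

section \<open>The Grothendieck group of a commutative semigroup\<close>

text \<open>
  The class of \<open>(a, b)\<close> is the formal difference of \<open>a\<close> and \<open>b\<close>.  The unit of \<open>S\<close>, if any, is not
  used.  Homomorphisms in the sense of \<^const>\<open>hom\<close> are semigroup homomorphisms.
\<close>

definition groth_rel :: "('s, 'x) monoid_scheme \<Rightarrow> (('s \<times> 's) \<times> ('s \<times> 's)) set"
  where "groth_rel S = {((a, b), (c, d)) | a b c d.
    a \<in> carrier S \<and> b \<in> carrier S \<and> c \<in> carrier S \<and> d \<in> carrier S \<and>
    (\<exists>e\<in>carrier S. a \<otimes>\<^bsub>S\<^esub> d \<otimes>\<^bsub>S\<^esub> e = c \<otimes>\<^bsub>S\<^esub> b \<otimes>\<^bsub>S\<^esub> e)}"

definition groth_class :: "('s, 'x) monoid_scheme \<Rightarrow> 's \<Rightarrow> 's \<Rightarrow> ('s \<times> 's) set"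
  where "groth_class S a b = groth_rel S `` {(a, b)}"

definition groth :: "('s, 'x) monoid_scheme \<Rightarrow> ('s \<times> 's) set monoid"
  where "groth S =
    \<lparr>carrier = (carrier S \<times> carrier S) // groth_rel S,
     mult = (\<lambda>X Y. \<Union>(a, b)\<in>X. \<Union>(c, d)\<in>Y. groth_class S (a \<otimes>\<^bsub>S\<^esub> c) (b \<otimes>\<^bsub>S\<^esub> d)),
     one = {(a, b). (a, b) \<in> carrier S \<times> carrier S \<and> (\<exists>e\<in>carrier S. a \<otimes>\<^bsub>S\<^esub> e = b \<otimes>\<^bsub>S\<^esub> e)}\<rparr>"

definition groth_unit :: "('s, 'x) monoid_scheme \<Rightarrow> 's \<Rightarrow> ('s \<times> 's) set"
  where "groth_unit S a = groth_class S (a \<otimes>\<^bsub>S\<^esub> a) a"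

definition groth_map ::
  "('s, 'x) monoid_scheme \<Rightarrow> ('t, 'y) monoid_scheme \<Rightarrow> ('s \<Rightarrow> 't) \<Rightarrow> ('s \<times> 's) set \<Rightarrow> ('t \<times> 't) set"
  where "groth_map S T f X = (\<Union>(a, b)\<in>X. groth_class T (f a) (f b))"

definition K0 :: "('a, 'r) ring_scheme \<Rightarrow> (('a, nat \<Rightarrow> 'a) rmodule set \<times> ('a, nat \<Rightarrow> 'a) rmodule set) set monoid"
  where "K0 R = groth (VR R)"

section \<open>The definitions have the expected properties\<close>

subsection \<open>Grothendieck groups\<close>

locale comm_semigp =
  fixes S (structure)
  assumes closed [simp, intro]: "\<lbrakk>x \<in> carrier S; y \<in> carrier S\<rbrakk> \<Longrightarrow> x \<otimes> y \<in> carrier S"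
    and assoc: "\<lbrakk>x \<in> carrier S; y \<in> carrier S; z \<in> carrier S\<rbrakk> \<Longrightarrow> (x \<otimes> y) \<otimes> z = x \<otimes> (y \<otimes> z)"
    and comm: "\<lbrakk>x \<in> carrier S; y \<in> carrier S\<rbrakk> \<Longrightarrow> x \<otimes> y = y \<otimes> x"
    and nonempty: "carrier S \<noteq> {}"
begin

lemma lcomm: "\<lbrakk>x \<in> carrier S; y \<in> carrier S; z \<in> carrier S\<rbrakk> \<Longrightarrow> x \<otimes> (y \<otimes> z) = y \<otimes> (x \<otimes> z)"
  by (metis assoc comm)

lemmas ac = assoc comm lcomm

lemma groth_rel_iff:
  "((a, b), (c, d)) \<in> groth_rel S \<longleftrightarrow>
    a \<in> carrier S \<and> b \<in> carrier S \<and> c \<in> carrier S \<and> d \<in> carrier S \<and>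
    (\<exists>e\<in>carrier S. a \<otimes> d \<otimes> e = c \<otimes> b \<otimes> e)"
  by (simp add: groth_rel_def)

lemma equiv_groth_rel: "equiv (carrier S \<times> carrier S) (groth_rel S)"
proof (rule equivI)
  show "groth_rel S \<subseteq> (carrier S \<times> carrier S) \<times> (carrier S \<times> carrier S)"
    by (auto simp: groth_rel_def)
  show "refl_on (carrier S \<times> carrier S) (groth_rel S)"
    using nonempty by (auto simp: refl_on_def groth_rel_def)
  show "sym (groth_rel S)"
    by (rule symI) (auto simp: groth_rel_def eq_commute)
  show "trans (groth_rel S)"
  proof (rule transI)
    fix p q r assume "(p, q) \<in> groth_rel S" "(q, r) \<in> groth_rel S"
    moreover obtain a b c d u v where e: "p = (a, b)" "q = (c, d)" "r = (u, v)"
      by (metis surj_pair)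
    ultimately obtain s t where *:
      "a \<in> carrier S" "b \<in> carrier S" "c \<in> carrier S" "d \<in> carrier S" "u \<in> carrier S" "v \<in> carrier S"
      "s \<in> carrier S" "t \<in> carrier S" "a \<otimes> d \<otimes> s = c \<otimes> b \<otimes> s" "c \<otimes> v \<otimes> t = u \<otimes> d \<otimes> t"
      unfolding e groth_rel_iff by blast
    have "a \<otimes> v \<otimes> (d \<otimes> s \<otimes> t) = (a \<otimes> d \<otimes> s) \<otimes> (v \<otimes> t)" using *(1-8) by (simp add: ac)
    also have "\<dots> = (c \<otimes> v \<otimes> t) \<otimes> (b \<otimes> s)" using *(1-8) unfolding *(9) by (simp add: ac)
    also have "\<dots> = u \<otimes> b \<otimes> (d \<otimes> s \<otimes> t)" using *(1-8) unfolding *(10) by (simp add: ac)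
    finally show "(p, r) \<in> groth_rel S"
      unfolding e groth_rel_iff using * by blast
  qed
qed

lemma groth_class_eq_iff:
  assumes "a \<in> carrier S" "b \<in> carrier S" "c \<in> carrier S" "d \<in> carrier S"
  shows "groth_class S a b = groth_class S c d \<longleftrightarrow> (\<exists>e\<in>carrier S. a \<otimes> d \<otimes> e = c \<otimes> b \<otimes> e)"
  unfolding groth_class_def
  using eq_equiv_class_iff[OF equiv_groth_rel, of "(a, b)" "(c, d)"] assms
  by (simp add: groth_rel_iff)

lemma groth_carrierE:
  assumes "X \<in> carrier (groth S)"
  obtains a b where "a \<in> carrier S" "b \<in> carrier S" "X = groth_class S a b"
  using assms by (auto simp: groth_def groth_class_def elim!: quotientE)

lemma groth_class_closed [simp, intro]:
  "\<lbrakk>a \<in> carrier S; b \<in> carrier S\<rbrakk> \<Longrightarrow> groth_class S a b \<in> carrier (groth S)"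
  by (auto simp: groth_def groth_class_def intro!: quotientI)

lemma in_groth_class:
  "(c, d) \<in> groth_class S a b \<longleftrightarrow>
    a \<in> carrier S \<and> b \<in> carrier S \<and> c \<in> carrier S \<and> d \<in> carrier S \<and> groth_class S c d = groth_class S a b"
  by (metis groth_class_eq_iff groth_rel_iff groth_class_def Image_singleton_iff)

lemma groth_class_self: "\<lbrakk>a \<in> carrier S; b \<in> carrier S\<rbrakk> \<Longrightarrow> (a, b) \<in> groth_class S a b"
  by (simp add: in_groth_class)

lemma groth_mult [simp]:
  assumes "a \<in> carrier S" "b \<in> carrier S" "c \<in> carrier S" "d \<in> carrier S"
  shows "groth_class S a b \<otimes>\<^bsub>groth S\<^esub> groth_class S c d = groth_class S (a \<otimes> c) (b \<otimes> d)"
proof -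
  have eq: "groth_class S (a' \<otimes> c') (b' \<otimes> d') = groth_class S (a \<otimes> c) (b \<otimes> d)"
    if "(a', b') \<in> groth_class S a b" "(c', d') \<in> groth_class S c d" for a' b' c' d'
  proof -
    from that have m: "a' \<in> carrier S" "b' \<in> carrier S" "c' \<in> carrier S" "d' \<in> carrier S"
      by (auto simp: in_groth_class)
    from that m assms obtain s t where st: "s \<in> carrier S" "t \<in> carrier S"
      "a' \<otimes> b \<otimes> s = a \<otimes> b' \<otimes> s" "c' \<otimes> d \<otimes> t = c \<otimes> d' \<otimes> t"
      by (auto simp: in_groth_class groth_class_eq_iff)
    have "a' \<otimes> c' \<otimes> (b \<otimes> d) \<otimes> (s \<otimes> t) = (a' \<otimes> b \<otimes> s) \<otimes> (c' \<otimes> d \<otimes> t)"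
      using m assms st(1,2) by (simp add: ac)
    also have "\<dots> = a \<otimes> c \<otimes> (b' \<otimes> d') \<otimes> (s \<otimes> t)"
      unfolding st(3,4) using m assms st(1,2) by (simp add: ac)
    finally show ?thesis using m assms st(1,2) by (subst groth_class_eq_iff) auto
  qed
  show ?thesis
    unfolding groth_def monoid.simps
  proof (intro equalityI subsetI)
    fix z assume "z \<in> (\<Union>(a, b)\<in>groth_class S a b. \<Union>(c, d)\<in>groth_class S c d. groth_class S (a \<otimes> c) (b \<otimes> d))"
    then obtain a' b' c' d' where *: "(a', b') \<in> groth_class S a b" "(c', d') \<in> groth_class S c d"
      "z \<in> groth_class S (a' \<otimes> c') (b' \<otimes> d')" by blast
    show "z \<in> groth_class S (a \<otimes> c) (b \<otimes> d)" using *(3) eq[OF *(1,2)] by simp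
  next
    fix z assume "z \<in> groth_class S (a \<otimes> c) (b \<otimes> d)"
    then show "z \<in> (\<Union>(a, b)\<in>groth_class S a b. \<Union>(c, d)\<in>groth_class S c d. groth_class S (a \<otimes> c) (b \<otimes> d))"
      using groth_class_self assms by blast
  qed
qed

lemma groth_one:
  assumes "a \<in> carrier S" shows "\<one>\<^bsub>groth S\<^esub> = groth_class S a a"
proof -
  have "(\<exists>e\<in>carrier S. c \<otimes> e = d \<otimes> e) \<longleftrightarrow> (\<exists>e\<in>carrier S. c \<otimes> a \<otimes> e = a \<otimes> d \<otimes> e)"
    if "c \<in> carrier S" "d \<in> carrier S" for c d
  proof
    assume "\<exists>e\<in>carrier S. c \<otimes> e = d \<otimes> e"
    then obtain e where e: "e \<in> carrier S" "c \<otimes> e = d \<otimes> e" by blast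
    have "c \<otimes> a \<otimes> e = a \<otimes> (c \<otimes> e)" using that assms e(1) by (simp add: ac)
    also have "\<dots> = a \<otimes> d \<otimes> e" unfolding e(2) using that assms e(1) by (simp add: ac)
    finally show "\<exists>e\<in>carrier S. c \<otimes> a \<otimes> e = a \<otimes> d \<otimes> e" using e(1) by blast
  next
    assume "\<exists>e\<in>carrier S. c \<otimes> a \<otimes> e = a \<otimes> d \<otimes> e"
    then obtain e where e: "e \<in> carrier S" "c \<otimes> a \<otimes> e = a \<otimes> d \<otimes> e" by blast
    have "c \<otimes> (a \<otimes> e) = c \<otimes> a \<otimes> e" using that assms e(1) by (simp add: assoc)
    also have "\<dots> = d \<otimes> (a \<otimes> e)" unfolding e(2) using that assms e(1) by (simp add: ac)
    finally show "\<exists>e\<in>carrier S. c \<otimes> e = d \<otimes> e" using e(1) assms by blast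
  qed
  then have "(c, d) \<in> \<one>\<^bsub>groth S\<^esub> \<longleftrightarrow> (c, d) \<in> groth_class S a a" for c d
    unfolding groth_class_def Image_singleton_iff groth_rel_iff groth_def monoid.simps mem_Collect_eq
      case_prod_conv mem_Times_iff fst_conv snd_conv
    using assms by metis
  then show ?thesis by auto
qed

lemma comm_group_groth: "comm_group (groth S)"
proof (rule comm_groupI)
  fix X Y assume "X \<in> carrier (groth S)" "Y \<in> carrier (groth S)"
  then show "X \<otimes>\<^bsub>groth S\<^esub> Y \<in> carrier (groth S)" "X \<otimes>\<^bsub>groth S\<^esub> Y = Y \<otimes>\<^bsub>groth S\<^esub> X"
    by (auto elim!: groth_carrierE simp: ac)
next
  show "\<one>\<^bsub>groth S\<^esub> \<in> carrier (groth S)" using nonempty groth_one by fastforce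
next
  fix X Y Z assume "X \<in> carrier (groth S)" "Y \<in> carrier (groth S)" "Z \<in> carrier (groth S)"
  then show "X \<otimes>\<^bsub>groth S\<^esub> Y \<otimes>\<^bsub>groth S\<^esub> Z = X \<otimes>\<^bsub>groth S\<^esub> (Y \<otimes>\<^bsub>groth S\<^esub> Z)"
    by (auto elim!: groth_carrierE simp: ac)
next
  fix X assume "X \<in> carrier (groth S)"
  then obtain a b where ab: "a \<in> carrier S" "b \<in> carrier S" "X = groth_class S a b"
    by (elim groth_carrierE)
  have "groth_class S (a \<otimes> a) (a \<otimes> b) = groth_class S a b"
    using ab(1,2) by (subst groth_class_eq_iff) (auto simp: ac)
  then show "\<one>\<^bsub>groth S\<^esub> \<otimes>\<^bsub>groth S\<^esub> X = X"
    using ab by (simp add: groth_one[of a])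
  have "groth_class S b a \<otimes>\<^bsub>groth S\<^esub> X = \<one>\<^bsub>groth S\<^esub>"
    using ab by (simp add: groth_one[of "a \<otimes> b"] comm)
  then show "\<exists>Y\<in>carrier (groth S). Y \<otimes>\<^bsub>groth S\<^esub> X = \<one>\<^bsub>groth S\<^esub>"
    using ab by blast
qed

lemma groth_unit_hom: "groth_unit S \<in> hom S (groth S)"
  by (rule homI) (auto simp: groth_unit_def ac)

lemma groth_class_eq_diff:
  assumes "a \<in> carrier S" "b \<in> carrier S"
  shows "groth_class S a b = groth_unit S a \<otimes>\<^bsub>groth S\<^esub> inv\<^bsub>groth S\<^esub> (groth_unit S b)"
proof -
  interpret G: comm_group "groth S" by (rule comm_group_groth)
  have "groth_class S a b \<otimes>\<^bsub>groth S\<^esub> groth_unit S b = groth_unit S a"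
    unfolding groth_unit_def using assms by (simp, subst groth_class_eq_iff) (auto simp: ac)
  then show ?thesis
    using assms hom_in_carrier[OF groth_unit_hom] by (metis G.inv_solve_right' groth_class_closed)
qed

theorem groth_universal:
  assumes H: "comm_group H" and f: "f \<in> hom S H"
  shows "\<exists>g\<in>hom (groth S) H. (\<forall>a\<in>carrier S. g (groth_unit S a) = f a) \<and>
    (\<forall>g'\<in>hom (groth S) H. (\<forall>a\<in>carrier S. g' (groth_unit S a) = f a) \<longrightarrow>
      (\<forall>X\<in>carrier (groth S). g' X = g X))"
proof -
  interpret H: comm_group H by (rule H)
  interpret G: comm_group "groth S" by (rule comm_group_groth)
  have fc [simp]: "f a \<in> carrier H" if "a \<in> carrier S" for a using f that by (rule hom_in_carrier)
  have fm [simp]: "f (a \<otimes> b) = f a \<otimes>\<^bsub>H\<^esub> f b" if "a \<in> carrier S" "b \<in> carrier S" for a b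
    using f that by (rule hom_mult)
  define g where "g X = (let p = SOME p. p \<in> X in f (fst p) \<otimes>\<^bsub>H\<^esub> inv\<^bsub>H\<^esub> f (snd p))" for X
  have g: "g (groth_class S a b) = f a \<otimes>\<^bsub>H\<^esub> inv\<^bsub>H\<^esub> f b"
    if ab: "a \<in> carrier S" "b \<in> carrier S" for a b
  proof -
    obtain c d where cd: "(SOME p. p \<in> groth_class S a b) = (c, d)" by fastforce
    have "(c, d) \<in> groth_class S a b"
      using groth_class_self[OF ab] by (metis cd someI_ex)
    then have m: "c \<in> carrier S" "d \<in> carrier S" and "groth_class S c d = groth_class S a b"
      by (auto simp: in_groth_class)
    then obtain e where e: "e \<in> carrier S" "c \<otimes> b \<otimes> e = a \<otimes> d \<otimes> e"
      using ab by (auto simp: groth_class_eq_iff)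
    have "f (c \<otimes> b \<otimes> e) = f (a \<otimes> d \<otimes> e)" by (simp add: e)
    then have "f c \<otimes>\<^bsub>H\<^esub> f b = f a \<otimes>\<^bsub>H\<^esub> f d" using m ab e(1) by simp
    then have "f c \<otimes>\<^bsub>H\<^esub> f b \<otimes>\<^bsub>H\<^esub> (inv\<^bsub>H\<^esub> f b \<otimes>\<^bsub>H\<^esub> inv\<^bsub>H\<^esub> f d) = f a \<otimes>\<^bsub>H\<^esub> f d \<otimes>\<^bsub>H\<^esub> (inv\<^bsub>H\<^esub> f b \<otimes>\<^bsub>H\<^esub> inv\<^bsub>H\<^esub> f d)"
      by simp
    moreover have "f c \<otimes>\<^bsub>H\<^esub> f b \<otimes>\<^bsub>H\<^esub> (inv\<^bsub>H\<^esub> f b \<otimes>\<^bsub>H\<^esub> inv\<^bsub>H\<^esub> f d) = f c \<otimes>\<^bsub>H\<^esub> inv\<^bsub>H\<^esub> f d"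
      using m ab by (metis (no_types, lifting) H.inv_closed H.m_assoc H.m_closed H.r_inv H.r_one fc)
    moreover have "f a \<otimes>\<^bsub>H\<^esub> f d \<otimes>\<^bsub>H\<^esub> (inv\<^bsub>H\<^esub> f b \<otimes>\<^bsub>H\<^esub> inv\<^bsub>H\<^esub> f d) = f a \<otimes>\<^bsub>H\<^esub> inv\<^bsub>H\<^esub> f b"
      using m ab by (metis (no_types, lifting) H.inv_closed H.m_assoc H.m_closed H.m_comm H.r_inv H.r_one fc)
    ultimately show ?thesis by (simp add: g_def cd)
  qed
  have ghom: "g \<in> hom (groth S) H"
  proof (rule homI)
    fix X assume "X \<in> carrier (groth S)"
    then show "g X \<in> carrier H" by (elim groth_carrierE) (simp add: g)
  next
    fix X Y assume "X \<in> carrier (groth S)" "Y \<in> carrier (groth S)"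
    then show "g (X \<otimes>\<^bsub>groth S\<^esub> Y) = g X \<otimes>\<^bsub>H\<^esub> g Y"
      by (elim groth_carrierE) (simp add: g H.inv_mult H.m_ac)
  qed
  have gu: "g (groth_unit S a) = f a" if "a \<in> carrier S" for a
    using that by (simp add: groth_unit_def g H.m_assoc)
  have uniq: "g' X = g X"
    if g': "g' \<in> hom (groth S) H" "\<forall>a\<in>carrier S. g' (groth_unit S a) = f a" and X: "X \<in> carrier (groth S)"
    for g' X
  proof -
    interpret g': group_hom "groth S" H g' using g' by unfold_locales
    from X obtain a b where ab: "a \<in> carrier S" "b \<in> carrier S" "X = groth_class S a b"
      by (elim groth_carrierE)
    have u: "groth_unit S a \<in> carrier (groth S)" "groth_unit S b \<in> carrier (groth S)"
      using ab hom_in_carrier[OF groth_unit_hom] by auto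
    then show ?thesis
      using g'(2) ab by (simp add: g[OF ab(1,2)] groth_class_eq_diff[OF ab(1,2)])
        (metis g groth_class_eq_diff)
  qed
  show ?thesis using ghom gu uniq by blast
qed

end

lemma comm_monoid_is_comm_semigp: "comm_monoid S \<Longrightarrow> comm_semigp S"
proof -
  assume "comm_monoid S"
  then interpret comm_monoid S .
  show ?thesis by unfold_locales (auto simp: m_ac)
qed

lemma groth_map_class:
  assumes S: "comm_semigp S" and T: "comm_semigp T" and f: "f \<in> hom S T"
    and ab: "a \<in> carrier S" "b \<in> carrier S"
  shows "groth_map S T f (groth_class S a b) = groth_class T (f a) (f b)"
proof -
  interpret S: comm_semigp S by (rule S)
  interpret T: comm_semigp T by (rule T)
  have fc: "f a \<in> carrier T" if "a \<in> carrier S" for a using f that by (rule hom_in_carrier)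
  have eq: "groth_class T (f c) (f d) = groth_class T (f a) (f b)" if "(c, d) \<in> groth_class S a b" for c d
  proof -
    from that have m: "c \<in> carrier S" "d \<in> carrier S" "groth_class S c d = groth_class S a b"
      by (auto simp: S.in_groth_class)
    then obtain e where e: "e \<in> carrier S" "c \<otimes>\<^bsub>S\<^esub> b \<otimes>\<^bsub>S\<^esub> e = a \<otimes>\<^bsub>S\<^esub> d \<otimes>\<^bsub>S\<^esub> e"
      using ab by (auto simp: S.groth_class_eq_iff)
    then have "f (c \<otimes>\<^bsub>S\<^esub> b \<otimes>\<^bsub>S\<^esub> e) = f (a \<otimes>\<^bsub>S\<^esub> d \<otimes>\<^bsub>S\<^esub> e)" by simp
    then show ?thesis
      using m ab e(1) fc by (subst T.groth_class_eq_iff) (auto simp: hom_mult[OF f])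
  qed
  show ?thesis unfolding groth_map_def
  proof (intro equalityI subsetI)
    fix z assume "z \<in> (\<Union>(a, b)\<in>groth_class S a b. groth_class T (f a) (f b))"
    then show "z \<in> groth_class T (f a) (f b)" using eq by blast
  next
    fix z assume "z \<in> groth_class T (f a) (f b)"
    then show "z \<in> (\<Union>(a, b)\<in>groth_class S a b. groth_class T (f a) (f b))"
      using S.groth_class_self[OF ab] by blast
  qed
qed

lemma groth_map_hom:
  assumes S: "comm_semigp S" and T: "comm_semigp T" and f: "f \<in> hom S T"
  shows "groth_map S T f \<in> hom (groth S) (groth T)"
proof -
  interpret S: comm_semigp S by (rule S)
  interpret T: comm_semigp T by (rule T)
  have fc: "f a \<in> carrier T" if "a \<in> carrier S" for a using f that by (rule hom_in_carrier)
  show ?thesis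
    by (rule homI; elim S.groth_carrierE)
      (auto simp: groth_map_class[OF S T f] fc hom_mult[OF f])
qed

text \<open>By \<open>groth_universal\<close>, this determines \<^const>\<open>groth_map\<close> on the carrier.\<close>

lemma groth_map_unit:
  assumes S: "comm_semigp S" and T: "comm_semigp T" and f: "f \<in> hom S T" and a: "a \<in> carrier S"
  shows "groth_map S T f (groth_unit S a) = groth_unit T (f a)"
proof -
  interpret S: comm_semigp S by (rule S)
  show ?thesis unfolding groth_unit_def
    using a by (simp add: groth_map_class[OF S T f] hom_mult[OF f])
qed

lemma (in comm_monoid) cyclic_submonoid_least:
  assumes x: "x \<in> carrier G"
  shows "submonoid (carrier (cyclic_submonoid G x)) G"
    and "x \<in> carrier (cyclic_submonoid G x)"
    and "\<lbrakk>submonoid H G; x \<in> H\<rbrakk> \<Longrightarrow> carrier (cyclic_submonoid G x) \<subseteq> H"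
proof -
  show "submonoid (carrier (cyclic_submonoid G x)) G"
  proof
    show "carrier (cyclic_submonoid G x) \<subseteq> carrier G" using x by (auto simp: cyclic_submonoid_def)
    show "\<one> \<in> carrier (cyclic_submonoid G x)"
      by (auto simp: cyclic_submonoid_def intro: range_eqI[of _ _ 0])
    show "y \<otimes> z \<in> carrier (cyclic_submonoid G x)"
      if "y \<in> carrier (cyclic_submonoid G x)" "z \<in> carrier (cyclic_submonoid G x)" for y z
      using that x by (auto simp: cyclic_submonoid_def nat_pow_mult)
  qed
  show "x \<in> carrier (cyclic_submonoid G x)"
    using x by (auto simp: cyclic_submonoid_def intro: range_eqI[of _ _ 1])
  assume H: "submonoid H G" "x \<in> H"
  have "x [^] n \<in> H" for n :: nat
    by (induction n) (use H in \<open>auto intro: submonoid.m_closed submonoid.one_closed\<close>)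
  then show "carrier (cyclic_submonoid G x) \<subseteq> H" by (auto simp: cyclic_submonoid_def)
qed

lemma (in comm_monoid) cyclic_submonoid_comm_monoid:
  assumes "x \<in> carrier G" shows "comm_monoid (cyclic_submonoid G x)"
proof -
  interpret H: submonoid "carrier (cyclic_submonoid G x)" G
    using assms by (rule cyclic_submonoid_least)
  have e: "cyclic_submonoid G x = G\<lparr>carrier := carrier (cyclic_submonoid G x)\<rparr>"
    by (simp add: cyclic_submonoid_def)
  show ?thesis
    by (subst e, rule comm_monoidI) (auto simp: m_ac)
qed

subsection \<open>Modules and their homomorphisms\<close>

context right_module
begin

lemma right_module_self: "right_module R M"
  by (rule right_module_axioms)

lemma ract_zero_right [simp]: "x \<in> carrier M \<Longrightarrow> x \<triangleleft>\<^bsub>M\<^esub> \<zero>\<^bsub>R\<^esub> = \<zero>\<^bsub>M\<^esub>"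
  using ract_add_right[of x "\<zero>\<^bsub>R\<^esub>" "\<zero>\<^bsub>R\<^esub>"]
  by (metis M.add.l_cancel_one' R.l_zero R.zero_closed ract_closed)

lemma ract_zero_left [simp]: "a \<in> carrier R \<Longrightarrow> \<zero>\<^bsub>M\<^esub> \<triangleleft>\<^bsub>M\<^esub> a = \<zero>\<^bsub>M\<^esub>"
  using ract_add_left[of "\<zero>\<^bsub>M\<^esub>" "\<zero>\<^bsub>M\<^esub>" a]
  by (metis M.add.l_cancel_one' M.l_zero M.zero_closed ract_closed)

end

lemma right_moduleI:
  assumes "ring R" "abelian_group M"
    and "\<And>x a. \<lbrakk>x \<in> carrier M; a \<in> carrier R\<rbrakk> \<Longrightarrow> x \<triangleleft>\<^bsub>M\<^esub> a \<in> carrier M"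
    and "\<And>x a b. \<lbrakk>x \<in> carrier M; a \<in> carrier R; b \<in> carrier R\<rbrakk> \<Longrightarrow>
        x \<triangleleft>\<^bsub>M\<^esub> (a \<oplus>\<^bsub>R\<^esub> b) = x \<triangleleft>\<^bsub>M\<^esub> a \<oplus>\<^bsub>M\<^esub> x \<triangleleft>\<^bsub>M\<^esub> b"
    and "\<And>x y a. \<lbrakk>x \<in> carrier M; y \<in> carrier M; a \<in> carrier R\<rbrakk> \<Longrightarrow>
        (x \<oplus>\<^bsub>M\<^esub> y) \<triangleleft>\<^bsub>M\<^esub> a = x \<triangleleft>\<^bsub>M\<^esub> a \<oplus>\<^bsub>M\<^esub> y \<triangleleft>\<^bsub>M\<^esub> a"
    and "\<And>x a b. \<lbrakk>x \<in> carrier M; a \<in> carrier R; b \<in> carrier R\<rbrakk> \<Longrightarrow>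
        x \<triangleleft>\<^bsub>M\<^esub> (a \<otimes>\<^bsub>R\<^esub> b) = (x \<triangleleft>\<^bsub>M\<^esub> a) \<triangleleft>\<^bsub>M\<^esub> b"
    and "\<And>x. x \<in> carrier M \<Longrightarrow> x \<triangleleft>\<^bsub>M\<^esub> \<one>\<^bsub>R\<^esub> = x"
  shows "right_module R M"
  using assms by (intro right_module.intro right_module_axioms.intro) auto

lemma additive_finsum:
  assumes M: "abelian_group M" and N: "abelian_group N"
    and f: "f \<in> carrier M \<rightarrow> carrier N"
    and add: "\<And>x y. \<lbrakk>x \<in> carrier M; y \<in> carrier M\<rbrakk> \<Longrightarrow> f (x \<oplus>\<^bsub>M\<^esub> y) = f x \<oplus>\<^bsub>N\<^esub> f y"
    and v: "v \<in> I \<rightarrow> carrier M"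
  shows "f (\<Oplus>\<^bsub>M\<^esub>i\<in>I. v i) = (\<Oplus>\<^bsub>N\<^esub>i\<in>I. f (v i))"
proof -
  interpret M: abelian_group M by (rule M)
  interpret N: abelian_group N by (rule N)
  have z: "f \<zero>\<^bsub>M\<^esub> = \<zero>\<^bsub>N\<^esub>"
    using add[of "\<zero>\<^bsub>M\<^esub>" "\<zero>\<^bsub>M\<^esub>"] f
    by (metis M.l_zero M.zero_closed N.add.l_cancel_one' PiE)
  show ?thesis using v
  proof (induction I rule: infinite_finite_induct)
    case (insert i I)
    then have "v \<in> I \<rightarrow> carrier M" "v i \<in> carrier M" "(\<lambda>i. f (v i)) \<in> I \<rightarrow> carrier N" "f (v i) \<in> carrier N"
      using f by auto
    with insert show ?case by (simp add: add)
  qed (simp_all add: z M.finsum_infinite N.finsum_infinite)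
qed

lemma rmod_homI:
  assumes "\<And>x. x \<in> carrier M \<Longrightarrow> f x \<in> carrier N"
    and "\<And>x y. \<lbrakk>x \<in> carrier M; y \<in> carrier M\<rbrakk> \<Longrightarrow> f (x \<oplus>\<^bsub>M\<^esub> y) = f x \<oplus>\<^bsub>N\<^esub> f y"
    and "\<And>x a. \<lbrakk>x \<in> carrier M; a \<in> carrier R\<rbrakk> \<Longrightarrow> f (x \<triangleleft>\<^bsub>M\<^esub> a) = f x \<triangleleft>\<^bsub>N\<^esub> a"
  shows "f \<in> rmod_hom R M N"
  using assms by (simp add: rmod_hom_def)

lemma rmod_hom_closed: "\<lbrakk>f \<in> rmod_hom R M N; x \<in> carrier M\<rbrakk> \<Longrightarrow> f x \<in> carrier N"
  by (auto simp: rmod_hom_def)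

lemma rmod_hom_add:
  "\<lbrakk>f \<in> rmod_hom R M N; x \<in> carrier M; y \<in> carrier M\<rbrakk> \<Longrightarrow> f (x \<oplus>\<^bsub>M\<^esub> y) = f x \<oplus>\<^bsub>N\<^esub> f y"
  by (auto simp: rmod_hom_def)

lemma rmod_hom_ract:
  "\<lbrakk>f \<in> rmod_hom R M N; x \<in> carrier M; a \<in> carrier R\<rbrakk> \<Longrightarrow> f (x \<triangleleft>\<^bsub>M\<^esub> a) = f x \<triangleleft>\<^bsub>N\<^esub> a"
  by (auto simp: rmod_hom_def)

lemmas rmod_hom_simps = rmod_hom_closed rmod_hom_add rmod_hom_ract

lemma rmod_hom_comp:
  "\<lbrakk>f \<in> rmod_hom R M N; g \<in> rmod_hom R N P\<rbrakk> \<Longrightarrow> (\<lambda>x. g (f x)) \<in> rmod_hom R M P"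
  by (rule rmod_homI) (simp_all add: rmod_hom_simps)

lemma rmod_hom_lincomb:
  assumes M: "right_module R M" and N: "right_module R N" and f: "f \<in> rmod_hom R M N"
    and x: "x \<in> I \<rightarrow> carrier M" and c: "c \<in> I \<rightarrow> carrier R"
  shows "f (\<Oplus>\<^bsub>M\<^esub>i\<in>I. x i \<triangleleft>\<^bsub>M\<^esub> c i) = (\<Oplus>\<^bsub>N\<^esub>i\<in>I. f (x i) \<triangleleft>\<^bsub>N\<^esub> c i)"
proof -
  interpret M: right_module R M by (rule M)
  interpret N: right_module R N by (rule N)
  have "f (\<Oplus>\<^bsub>M\<^esub>i\<in>I. x i \<triangleleft>\<^bsub>M\<^esub> c i) = (\<Oplus>\<^bsub>N\<^esub>i\<in>I. f (x i \<triangleleft>\<^bsub>M\<^esub> c i))"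
    by (rule additive_finsum) (use f x c in \<open>auto simp: rmod_hom_simps Pi_iff M.M.abelian_group_axioms N.M.abelian_group_axioms\<close>)
  also have "\<dots> = (\<Oplus>\<^bsub>N\<^esub>i\<in>I. f (x i) \<triangleleft>\<^bsub>N\<^esub> c i)"
    by (rule N.M.finsum_cong') (use f x c in \<open>auto simp: rmod_hom_simps Pi_iff\<close>)
  finally show ?thesis .
qed

lemma rmod_isoI:
  assumes "f \<in> rmod_hom R M N" "\<And>y. y \<in> carrier N \<Longrightarrow> g y \<in> carrier M"
    "\<And>x. x \<in> carrier M \<Longrightarrow> g (f x) = x" "\<And>y. y \<in> carrier N \<Longrightarrow> f (g y) = y"
  shows "rmod_iso R M N"
  unfolding rmod_iso_def
  by (rule bexI[OF _ assms(1)], rule bij_betw_byWitness[where f' = g])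
    (use assms in \<open>auto simp: rmod_hom_closed\<close>)

lemma rmod_isoE:
  assumes M: "right_module R M" and "rmod_iso R M N"
  obtains f g where "f \<in> rmod_hom R M N" "g \<in> rmod_hom R N M"
    "\<And>x. x \<in> carrier M \<Longrightarrow> g (f x) = x" "\<And>y. y \<in> carrier N \<Longrightarrow> f (g y) = y"
proof -
  interpret M: right_module R M by (rule M)
  from assms obtain f where f: "f \<in> rmod_hom R M N" "bij_betw f (carrier M) (carrier N)"
    by (auto simp: rmod_iso_def)
  define g where "g = inv_into (carrier M) f"
  have gf: "g (f x) = x" if "x \<in> carrier M" for x
    using f(2) that by (simp add: g_def bij_betw_inv_into_left)
  have fg: "f (g y) = y" if "y \<in> carrier N" for y
    using f(2) that by (simp add: g_def bij_betw_inv_into_right)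
  have ex: "\<exists>x\<in>carrier M. y = f x" if "y \<in> carrier N" for y
    using f(2) that by (auto simp: bij_betw_def)
  have "g \<in> rmod_hom R N M"
  proof (rule rmod_homI)
    fix y assume "y \<in> carrier N" then show "g y \<in> carrier M" using ex gf by fastforce
  next
    fix y z assume "y \<in> carrier N" "z \<in> carrier N"
    then obtain x x' where "x \<in> carrier M" "x' \<in> carrier M" "y = f x" "z = f x'" using ex by meson
    then show "g (y \<oplus>\<^bsub>N\<^esub> z) = g y \<oplus>\<^bsub>M\<^esub> g z" by (simp add: gf rmod_hom_add[OF f(1), symmetric])
  next
    fix y a assume "y \<in> carrier N" "a \<in> carrier R"
    then obtain x where "x \<in> carrier M" "a \<in> carrier R" "y = f x" using ex by meson
    then show "g (y \<triangleleft>\<^bsub>N\<^esub> a) = g y \<triangleleft>\<^bsub>M\<^esub> a" by (simp add: gf rmod_hom_ract[OF f(1), symmetric])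
  qed
  with f(1) gf fg show ?thesis using that by blast
qed

lemma rmod_iso_refl: "rmod_iso R M M"
  by (rule rmod_isoI[where f = "\<lambda>x. x" and g = "\<lambda>x. x"]) (auto intro: rmod_homI)

lemma rmod_iso_sym:
  assumes "right_module R M" "rmod_iso R M N" shows "rmod_iso R N M"
proof -
  obtain f g where "f \<in> rmod_hom R M N" "g \<in> rmod_hom R N M"
    "\<And>x. x \<in> carrier M \<Longrightarrow> g (f x) = x" "\<And>y. y \<in> carrier N \<Longrightarrow> f (g y) = y"
    using rmod_isoE[OF assms] by metis
  then show ?thesis by (intro rmod_isoI[where f = g and g = f]) (simp_all add: rmod_hom_closed)
qed

lemma rmod_iso_trans:
  assumes "rmod_iso R M N" "rmod_iso R N P" shows "rmod_iso R M P"
proof -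
  obtain f g where fg: "f \<in> rmod_hom R M N" "bij_betw f (carrier M) (carrier N)"
    "g \<in> rmod_hom R N P" "bij_betw g (carrier N) (carrier P)"
    using assms unfolding rmod_iso_def by (elim bexE)
  show ?thesis unfolding rmod_iso_def
    by (rule bexI[OF _ rmod_hom_comp[OF fg(1,3)]]) (rule bij_betw_trans[OF fg(2,4), unfolded comp_def])
qed

lemma ex_copy:
  fixes M :: "('a, 'm, 'x) rmodule_scheme" and \<phi> :: "'m \<Rightarrow> 'n"
  assumes M: "right_module R M" and \<phi>: "inj_on \<phi> (carrier M)"
  shows "\<exists>N :: ('a, 'n) rmodule. right_module R N \<and> rmod_iso R N M"
proof -
  interpret M: right_module R M by (rule M)
  define \<psi> where "\<psi> = inv_into (carrier M) \<phi>"
  have \<psi> [simp]: "\<psi> (\<phi> x) = x" if "x \<in> carrier M" for x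
    using \<phi> that by (simp add: \<psi>_def)
  define N :: "('a, 'n) rmodule" where "N =
    \<lparr>carrier = \<phi> ` carrier M, mult = undefined, one = undefined, zero = \<phi> \<zero>\<^bsub>M\<^esub>,
     add = (\<lambda>x y. \<phi> (\<psi> x \<oplus>\<^bsub>M\<^esub> \<psi> y)), ract = (\<lambda>x a. \<phi> (\<psi> x \<triangleleft>\<^bsub>M\<^esub> a))\<rparr>"
  have N [simp]: "carrier N = \<phi> ` carrier M" "\<zero>\<^bsub>N\<^esub> = \<phi> \<zero>\<^bsub>M\<^esub>"
    "x \<oplus>\<^bsub>N\<^esub> y = \<phi> (\<psi> x \<oplus>\<^bsub>M\<^esub> \<psi> y)" "x \<triangleleft>\<^bsub>N\<^esub> a = \<phi> (\<psi> x \<triangleleft>\<^bsub>M\<^esub> a)" for x y a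
    by (simp_all add: N_def)
  have "abelian_group N"
  proof (rule abelian_groupI)
    fix y assume "y \<in> carrier N"
    then obtain x where x: "x \<in> carrier M" "y = \<phi> x" by auto
    then show "\<exists>z\<in>carrier N. z \<oplus>\<^bsub>N\<^esub> y = \<zero>\<^bsub>N\<^esub>"
      by (intro bexI[of _ "\<phi> (\<ominus>\<^bsub>M\<^esub> x)"]) (simp_all add: M.M.l_neg)
  qed (auto simp: M.M.a_ac)
  then have "right_module R N"
    by (intro right_moduleI)
      (auto simp: M.R.ring_axioms M.ract_add_right M.ract_add_left M.ract_assoc)
  moreover have "rmod_iso R N M"
    by (rule rmod_isoI[where f = \<psi> and g = \<phi>]) (auto intro!: rmod_homI)
  ultimately show ?thesis by blast
qed

lemma fin_gen_image:
  assumes M: "right_module R M" and N: "right_module R N"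
    and f: "f \<in> rmod_hom R M N" "f ` carrier M = carrier N" and "fin_gen R M"
  shows "fin_gen R N"
proof -
  from \<open>fin_gen R M\<close> obtain n :: nat and x where x: "x \<in> {..<n} \<rightarrow> carrier M"
    and gen: "\<And>m. m \<in> carrier M \<Longrightarrow> \<exists>c \<in> {..<n} \<rightarrow> carrier R. m = (\<Oplus>\<^bsub>M\<^esub>i\<in>{..<n}. x i \<triangleleft>\<^bsub>M\<^esub> c i)"
    unfolding fin_gen_def by blast
  show ?thesis unfolding fin_gen_def
  proof (intro exI[of _ n] bexI[of _ "\<lambda>i. f (x i)"] ballI)
    show "(\<lambda>i. f (x i)) \<in> {..<n} \<rightarrow> carrier N" using x f by (auto simp: rmod_hom_closed)
    fix y assume "y \<in> carrier N"
    then obtain m where m: "m \<in> carrier M" "y = f m" using f(2) by auto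
    from gen[OF m(1)] obtain c where c: "c \<in> {..<n} \<rightarrow> carrier R"
      "m = (\<Oplus>\<^bsub>M\<^esub>i\<in>{..<n}. x i \<triangleleft>\<^bsub>M\<^esub> c i)" by blast
    then show "\<exists>c \<in> {..<n} \<rightarrow> carrier R. y = (\<Oplus>\<^bsub>N\<^esub>i\<in>{..<n}. f (x i) \<triangleleft>\<^bsub>N\<^esub> c i)"
      using rmod_hom_lincomb[OF M N f(1) x c(1)] m(2) by auto
  qed
qed

lemma projectiveD:
  fixes B C :: "('a, nat \<Rightarrow> 'a) rmodule" and P :: "('a, 'm, 'x) rmodule_scheme"
  assumes "projective R P" "right_module R B" "right_module R C"
    "g \<in> rmod_hom R B C" "g ` carrier B = carrier C" "h \<in> rmod_hom R P C"
  shows "\<exists>k\<in>rmod_hom R P B. \<forall>p\<in>carrier P. g (k p) = h p"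
  using assms unfolding projective_def by blast

lemma projective_iso:
  assumes M: "right_module R M" and N: "right_module R N" and iso: "rmod_iso R M N"
    and proj: "projective R M"
  shows "projective R N"
proof -
  obtain f g where fg: "f \<in> rmod_hom R M N" "g \<in> rmod_hom R N M"
    "\<And>x. x \<in> carrier M \<Longrightarrow> g (f x) = x" "\<And>y. y \<in> carrier N \<Longrightarrow> f (g y) = y"
    using rmod_isoE[OF M iso] by metis
  show ?thesis unfolding projective_def
  proof (intro allI impI)
    fix B C :: "('a, nat \<Rightarrow> 'a) rmodule" and p h
    assume BC: "right_module R B" "right_module R C" "p \<in> rmod_hom R B C"
      "p ` carrier B = carrier C" "h \<in> rmod_hom R N C"
    have "(\<lambda>x. h (f x)) \<in> rmod_hom R M C" using fg(1) BC(5) by (rule rmod_hom_comp)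
    then obtain k where k: "k \<in> rmod_hom R M B" "\<forall>x\<in>carrier M. p (k x) = h (f x)"
      using proj BC unfolding projective_def by blast
    then show "\<exists>k\<in>rmod_hom R N B. \<forall>y\<in>carrier N. p (k y) = h y"
      using fg by (intro bexI[OF _ rmod_hom_comp[OF fg(2) k(1)]]) (auto simp: rmod_hom_closed)
  qed
qed

lemma fg_projective_iso:
  assumes M: "fg_projective R M" and N: "right_module R N" and iso: "rmod_iso R M N"
  shows "fg_projective R N"
proof -
  from iso obtain f where "f \<in> rmod_hom R M N" "f ` carrier M = carrier N"
    by (auto simp: rmod_iso_def bij_betw_def)
  moreover have rM: "right_module R M" and "fin_gen R M" "projective R M"
    using M by (simp_all add: fg_projective_def)
  ultimately show ?thesis
    unfolding fg_projective_def using N fin_gen_image[OF rM N] projective_iso[OF rM N iso] by simp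
qed

lemma ex_small_copy:
  fixes M :: "('a, 'm, 'x) rmodule_scheme"
  assumes M: "right_module R M" and fg: "fin_gen R M"
  shows "\<exists>P :: ('a, nat \<Rightarrow> 'a) rmodule. right_module R P \<and> rmod_iso R P M"
proof -
  from fg obtain n :: nat and x where x: "x \<in> {..<n} \<rightarrow> carrier M"
    and gen: "\<forall>m\<in>carrier M. \<exists>c. c \<in> {..<n} \<rightarrow> carrier R \<and> m = (\<Oplus>\<^bsub>M\<^esub>i\<in>{..<n}. x i \<triangleleft>\<^bsub>M\<^esub> c i)"
    unfolding fin_gen_def by blast
  from bchoice[OF gen] obtain c
    where c: "\<forall>m\<in>carrier M. c m \<in> {..<n} \<rightarrow> carrier R \<and> m = (\<Oplus>\<^bsub>M\<^esub>i\<in>{..<n}. x i \<triangleleft>\<^bsub>M\<^esub> c m i)" ..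
  have "inj_on c (carrier M)"
  proof (rule inj_onI)
    fix p q assume p: "p \<in> carrier M" and q: "q \<in> carrier M" and eq: "c p = c q"
    have "p = (\<Oplus>\<^bsub>M\<^esub>i\<in>{..<n}. x i \<triangleleft>\<^bsub>M\<^esub> c p i)" using c p by blast
    also have "\<dots> = q" unfolding eq using c q by simp
    finally show "p = q" .
  qed
  with M show ?thesis by (rule ex_copy)
qed

lemma fg_projective_copy:
  fixes M :: "('a, 'm, 'x) rmodule_scheme"
  assumes "fg_projective R M"
  shows "\<exists>P :: ('a, nat \<Rightarrow> 'a) rmodule. fg_projective R P \<and> rmod_iso R P M"
proof -
  have M: "right_module R M" "fin_gen R M" using assms by (auto simp: fg_projective_def)
  obtain P :: "('a, nat \<Rightarrow> 'a) rmodule" where P: "right_module R P" "rmod_iso R P M"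
    using ex_small_copy[OF M] by blast
  have "fg_projective R P"
    by (rule fg_projective_iso[OF assms P(1) rmod_iso_sym[OF P]])
  with P(2) show ?thesis by blast
qed

subsection \<open>Free modules and the lifting property in arbitrary types\<close>

definition free_rmodule :: "('a, 'r) ring_scheme \<Rightarrow> nat \<Rightarrow> ('a, nat \<Rightarrow> 'a) rmodule"
  where "free_rmodule R n =
    \<lparr>carrier = {v. (\<forall>i<n. v i \<in> carrier R) \<and> (\<forall>i\<ge>n. v i = \<zero>\<^bsub>R\<^esub>)},
     mult = undefined, one = undefined, zero = (\<lambda>_. \<zero>\<^bsub>R\<^esub>),
     add = (\<lambda>v w i. v i \<oplus>\<^bsub>R\<^esub> w i), ract = (\<lambda>v a i. v i \<otimes>\<^bsub>R\<^esub> a)\<rparr>"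

lemma free_rmodule_simps [simp]:
  "v \<in> carrier (free_rmodule R n) \<longleftrightarrow> (\<forall>i<n. v i \<in> carrier R) \<and> (\<forall>i\<ge>n. v i = \<zero>\<^bsub>R\<^esub>)"
  "\<zero>\<^bsub>free_rmodule R n\<^esub> = (\<lambda>_. \<zero>\<^bsub>R\<^esub>)"
  "v \<oplus>\<^bsub>free_rmodule R n\<^esub> w = (\<lambda>i. v i \<oplus>\<^bsub>R\<^esub> w i)"
  "v \<triangleleft>\<^bsub>free_rmodule R n\<^esub> a = (\<lambda>i. v i \<otimes>\<^bsub>R\<^esub> a)"
  by (simp_all add: free_rmodule_def)

lemma right_module_free:
  assumes "ring R" shows "right_module R (free_rmodule R n)"
proof -
  interpret ring R by (rule assms)
  have mem: "v i \<in> carrier R" if "\<forall>i<n. v i \<in> carrier R" "\<forall>i\<ge>n. v i = \<zero>\<^bsub>R\<^esub>" for v i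
    using that by (cases "i < n") auto
  have "abelian_group (free_rmodule R n)"
  proof (rule abelian_groupI)
    fix v assume v: "v \<in> carrier (free_rmodule R n)"
    then show "\<exists>w\<in>carrier (free_rmodule R n). w \<oplus>\<^bsub>free_rmodule R n\<^esub> v = \<zero>\<^bsub>free_rmodule R n\<^esub>"
      by (intro bexI[of _ "\<lambda>i. \<ominus>\<^bsub>R\<^esub> v i"]) (auto simp: l_neg mem)
  qed (auto simp: fun_eq_iff mem a_ac)
  then show ?thesis
    by (intro right_moduleI) (auto simp: fun_eq_iff assms r_distr l_distr m_assoc mem)
qed

lemma lincomb_hom:
  assumes M: "right_module R M" and x: "x \<in> {..<n} \<rightarrow> carrier M"
  shows "(\<lambda>v. \<Oplus>\<^bsub>M\<^esub>i\<in>{..<n}. x i \<triangleleft>\<^bsub>M\<^esub> v i) \<in> rmod_hom R (free_rmodule R n) M"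
proof -
  interpret M: right_module R M by (rule M)
  have xi: "x i \<in> carrier M" if "i < n" for i using x that by auto
  show ?thesis
  proof (rule rmod_homI)
    fix v assume v: "v \<in> carrier (free_rmodule R n)"
    show "(\<Oplus>\<^bsub>M\<^esub>i\<in>{..<n}. x i \<triangleleft>\<^bsub>M\<^esub> v i) \<in> carrier M"
      by (rule M.M.finsum_closed) (use v xi in auto)
  next
    fix v w assume v: "v \<in> carrier (free_rmodule R n)" "w \<in> carrier (free_rmodule R n)"
    have "(\<Oplus>\<^bsub>M\<^esub>i\<in>{..<n}. x i \<triangleleft>\<^bsub>M\<^esub> (v i \<oplus>\<^bsub>R\<^esub> w i)) =
        (\<Oplus>\<^bsub>M\<^esub>i\<in>{..<n}. x i \<triangleleft>\<^bsub>M\<^esub> v i \<oplus>\<^bsub>M\<^esub> x i \<triangleleft>\<^bsub>M\<^esub> w i)"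
      by (rule M.M.finsum_cong') (use v xi in \<open>auto simp: M.ract_add_right\<close>)
    also have "\<dots> = (\<Oplus>\<^bsub>M\<^esub>i\<in>{..<n}. x i \<triangleleft>\<^bsub>M\<^esub> v i) \<oplus>\<^bsub>M\<^esub> (\<Oplus>\<^bsub>M\<^esub>i\<in>{..<n}. x i \<triangleleft>\<^bsub>M\<^esub> w i)"
      by (rule M.M.finsum_addf) (use v xi in auto)
    finally show "(\<Oplus>\<^bsub>M\<^esub>i\<in>{..<n}. x i \<triangleleft>\<^bsub>M\<^esub> (v \<oplus>\<^bsub>free_rmodule R n\<^esub> w) i) =
      (\<Oplus>\<^bsub>M\<^esub>i\<in>{..<n}. x i \<triangleleft>\<^bsub>M\<^esub> v i) \<oplus>\<^bsub>M\<^esub> (\<Oplus>\<^bsub>M\<^esub>i\<in>{..<n}. x i \<triangleleft>\<^bsub>M\<^esub> w i)" by simp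
  next
    fix v a assume v: "v \<in> carrier (free_rmodule R n)" and a: "a \<in> carrier R"
    have "(\<Oplus>\<^bsub>M\<^esub>i\<in>{..<n}. x i \<triangleleft>\<^bsub>M\<^esub> v i) \<triangleleft>\<^bsub>M\<^esub> a = (\<Oplus>\<^bsub>M\<^esub>i\<in>{..<n}. x i \<triangleleft>\<^bsub>M\<^esub> v i \<triangleleft>\<^bsub>M\<^esub> a)"
      by (rule additive_finsum[where f = "\<lambda>y. y \<triangleleft>\<^bsub>M\<^esub> a"])
        (use v xi a in \<open>auto simp: M.ract_add_left M.M.abelian_group_axioms\<close>)
    also have "\<dots> = (\<Oplus>\<^bsub>M\<^esub>i\<in>{..<n}. x i \<triangleleft>\<^bsub>M\<^esub> (v i \<otimes>\<^bsub>R\<^esub> a))"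
      by (rule M.M.finsum_cong') (use v xi a in \<open>auto simp: M.ract_assoc\<close>)
    finally show "(\<Oplus>\<^bsub>M\<^esub>i\<in>{..<n}. x i \<triangleleft>\<^bsub>M\<^esub> (v \<triangleleft>\<^bsub>free_rmodule R n\<^esub> a) i) =
      (\<Oplus>\<^bsub>M\<^esub>i\<in>{..<n}. x i \<triangleleft>\<^bsub>M\<^esub> v i) \<triangleleft>\<^bsub>M\<^esub> a" by simp
  qed
qed

lemma fg_projective_split:
  assumes P: "fg_projective R P"
  obtains n :: nat and x s where "x \<in> {..<n} \<rightarrow> carrier P" "s \<in> rmod_hom R P (free_rmodule R n)"
    "\<And>p. p \<in> carrier P \<Longrightarrow> (\<Oplus>\<^bsub>P\<^esub>i\<in>{..<n}. x i \<triangleleft>\<^bsub>P\<^esub> s p i) = p"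
proof -
  have rP: "right_module R P" and fg: "fin_gen R P" and pr: "projective R P"
    using P by (auto simp: fg_projective_def)
  interpret P: right_module R P by (rule rP)
  from fg obtain n :: nat and x where x: "x \<in> {..<n} \<rightarrow> carrier P"
    and gen: "\<And>m. m \<in> carrier P \<Longrightarrow> \<exists>c \<in> {..<n} \<rightarrow> carrier R. m = (\<Oplus>\<^bsub>P\<^esub>i\<in>{..<n}. x i \<triangleleft>\<^bsub>P\<^esub> c i)"
    unfolding fin_gen_def by blast
  have xi: "x i \<in> carrier P" if "i < n" for i using x that by auto
  define \<pi> where "\<pi> = (\<lambda>v. \<Oplus>\<^bsub>P\<^esub>i\<in>{..<n}. x i \<triangleleft>\<^bsub>P\<^esub> v i)"
  have \<pi>: "\<pi> \<in> rmod_hom R (free_rmodule R n) P"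
    unfolding \<pi>_def using rP x by (rule lincomb_hom)
  have surj: "\<exists>v\<in>carrier (free_rmodule R n). \<pi> v = p" if p: "p \<in> carrier P" for p
  proof -
    from gen[OF p] obtain c where c: "c \<in> {..<n} \<rightarrow> carrier R" "p = (\<Oplus>\<^bsub>P\<^esub>i\<in>{..<n}. x i \<triangleleft>\<^bsub>P\<^esub> c i)"
      by blast
    have "\<pi> (\<lambda>i. if i < n then c i else \<zero>\<^bsub>R\<^esub>) = p"
      unfolding \<pi>_def c(2) by (rule P.M.finsum_cong') (use c(1) xi in auto)
    then show ?thesis using c(1) by (intro bexI[of _ "\<lambda>i. if i < n then c i else \<zero>\<^bsub>R\<^esub>"]) auto
  qed
  obtain P' :: "('a, nat \<Rightarrow> 'a) rmodule" where P': "right_module R P'" "rmod_iso R P' P"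
    using ex_small_copy[OF rP fg] by blast
  obtain f g where f: "f \<in> rmod_hom R P' P" and g: "g \<in> rmod_hom R P P'"
    and gf: "\<And>x. x \<in> carrier P' \<Longrightarrow> g (f x) = x" and fg: "\<And>y. y \<in> carrier P \<Longrightarrow> f (g y) = y"
    using rmod_isoE[OF P'] by metis
  have F: "right_module R (free_rmodule R n)" by (rule right_module_free) (rule P.R.ring_axioms)
  have h: "(\<lambda>v. g (\<pi> v)) \<in> rmod_hom R (free_rmodule R n) P'" using \<pi> g by (rule rmod_hom_comp)
  have "(\<lambda>v. g (\<pi> v)) ` carrier (free_rmodule R n) = carrier P'"
  proof
    show "(\<lambda>v. g (\<pi> v)) ` carrier (free_rmodule R n) \<subseteq> carrier P'"
      using rmod_hom_closed[OF h] by (rule image_subsetI)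
    show "carrier P' \<subseteq> (\<lambda>v. g (\<pi> v)) ` carrier (free_rmodule R n)"
    proof
      fix y assume y: "y \<in> carrier P'"
      from surj[OF rmod_hom_closed[OF f y]]
      obtain v where v: "v \<in> carrier (free_rmodule R n)" "\<pi> v = f y" ..
      show "y \<in> (\<lambda>v. g (\<pi> v)) ` carrier (free_rmodule R n)"
        by (rule image_eqI[OF _ v(1)]) (simp add: v(2) gf[OF y])
    qed
  qed
  from projectiveD[OF pr F P'(1) h this g]
  obtain s where s: "s \<in> rmod_hom R P (free_rmodule R n)" and "\<forall>p\<in>carrier P. g (\<pi> (s p)) = g p" ..
  then have gs: "g (\<pi> (s p)) = g p" if "p \<in> carrier P" for p using that by simp
  have "\<pi> (s p) = p" if p: "p \<in> carrier P" for p
    using arg_cong[OF gs[OF p], of f] fg[OF p] fg[OF rmod_hom_closed[OF \<pi> rmod_hom_closed[OF s p]]]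
    by simp
  then show ?thesis using that[OF x s] unfolding \<pi>_def by simp
qed

theorem fg_projective_lift:
  fixes B :: "('a, 'b, 'x) rmodule_scheme" and C :: "('a, 'c, 'y) rmodule_scheme"
  assumes P: "fg_projective R P" and B: "right_module R B" and C: "right_module R C"
    and g: "g \<in> rmod_hom R B C" "g ` carrier B = carrier C" and h: "h \<in> rmod_hom R P C"
  shows "\<exists>k\<in>rmod_hom R P B. \<forall>p\<in>carrier P. g (k p) = h p"
proof -
  have rP: "right_module R P" using P by (simp add: fg_projective_def)
  obtain n :: nat and x s where x: "x \<in> {..<n} \<rightarrow> carrier P" and s: "s \<in> rmod_hom R P (free_rmodule R n)"
    and xs: "\<And>p. p \<in> carrier P \<Longrightarrow> (\<Oplus>\<^bsub>P\<^esub>i\<in>{..<n}. x i \<triangleleft>\<^bsub>P\<^esub> s p i) = p"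
    by (rule fg_projective_split[OF P]) (rule that)
  interpret C: right_module R C by (rule C)
  have "\<forall>i. \<exists>b. i < n \<longrightarrow> b \<in> carrier B \<and> g b = h (x i)"
  proof (intro allI)
    fix i
    have "h (x i) \<in> g ` carrier B" if "i < n" unfolding g(2) using x that by (intro rmod_hom_closed[OF h]) auto
    then show "\<exists>b. i < n \<longrightarrow> b \<in> carrier B \<and> g b = h (x i)" by fastforce
  qed
  then obtain b where "\<forall>i. i < n \<longrightarrow> b i \<in> carrier B \<and> g (b i) = h (x i)" by (rule choice[THEN exE])
  then have b: "\<And>i. i < n \<Longrightarrow> b i \<in> carrier B" "\<And>i. i < n \<Longrightarrow> g (b i) = h (x i)" by simp_all
  then have b': "b \<in> {..<n} \<rightarrow> carrier B" by auto
  have k: "(\<lambda>p. \<Oplus>\<^bsub>B\<^esub>i\<in>{..<n}. b i \<triangleleft>\<^bsub>B\<^esub> s p i) \<in> rmod_hom R P B"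
    by (rule rmod_hom_comp[OF s lincomb_hom[OF B b']])
  have "g (\<Oplus>\<^bsub>B\<^esub>i\<in>{..<n}. b i \<triangleleft>\<^bsub>B\<^esub> s p i) = h p" if p: "p \<in> carrier P" for p
  proof -
    have sp: "s p \<in> {..<n} \<rightarrow> carrier R" using rmod_hom_closed[OF s p] by auto
    have "g (\<Oplus>\<^bsub>B\<^esub>i\<in>{..<n}. b i \<triangleleft>\<^bsub>B\<^esub> s p i) = (\<Oplus>\<^bsub>C\<^esub>i\<in>{..<n}. g (b i) \<triangleleft>\<^bsub>C\<^esub> s p i)"
      by (rule rmod_hom_lincomb[OF B C g(1) b' sp])
    also have "\<dots> = (\<Oplus>\<^bsub>C\<^esub>i\<in>{..<n}. h (x i) \<triangleleft>\<^bsub>C\<^esub> s p i)"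
      by (rule C.M.finsum_cong') (use b sp x rmod_hom_closed[OF h] in \<open>auto simp: Pi_iff\<close>)
    also have "\<dots> = h (\<Oplus>\<^bsub>P\<^esub>i\<in>{..<n}. x i \<triangleleft>\<^bsub>P\<^esub> s p i)"
      by (rule rmod_hom_lincomb[OF rP C h x sp, symmetric])
    finally show ?thesis using xs[OF p] by simp
  qed
  then show ?thesis by (intro bexI[OF _ k]) simp
qed

subsection \<open>Direct sums\<close>

lemma direct_sum_simps [simp]:
  "carrier (direct_sum M N) = carrier M \<times> carrier N"
  "\<zero>\<^bsub>direct_sum M N\<^esub> = (\<zero>\<^bsub>M\<^esub>, \<zero>\<^bsub>N\<^esub>)"
  "(x, y) \<oplus>\<^bsub>direct_sum M N\<^esub> (x', y') = (x \<oplus>\<^bsub>M\<^esub> x', y \<oplus>\<^bsub>N\<^esub> y')"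
  "(x, y) \<triangleleft>\<^bsub>direct_sum M N\<^esub> a = (x \<triangleleft>\<^bsub>M\<^esub> a, y \<triangleleft>\<^bsub>N\<^esub> a)"
  by (simp_all add: direct_sum_def)

lemma right_module_direct_sum:
  assumes M: "right_module R M" and N: "right_module R N"
  shows "right_module R (direct_sum M N)"
proof -
  interpret M: right_module R M by (rule M)
  interpret N: right_module R N by (rule N)
  have "abelian_group (direct_sum M N)"
  proof (rule abelian_groupI)
    fix p assume "p \<in> carrier (direct_sum M N)"
    then obtain x y where "p = (x, y)" "x \<in> carrier M" "y \<in> carrier N" by auto
    then show "\<exists>q\<in>carrier (direct_sum M N). q \<oplus>\<^bsub>direct_sum M N\<^esub> p = \<zero>\<^bsub>direct_sum M N\<^esub>"
      by (intro bexI[of _ "(\<ominus>\<^bsub>M\<^esub> x, \<ominus>\<^bsub>N\<^esub> y)"]) (simp_all add: M.M.l_neg N.M.l_neg)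
  qed (auto simp: M.M.a_ac N.M.a_ac)
  then show ?thesis
    by (intro right_moduleI)
      (auto simp: M.R.ring_axioms M.ract_add_right M.ract_add_left M.ract_assoc
        N.ract_add_right N.ract_add_left N.ract_assoc)
qed

lemma fin_gen_direct_sum:
  assumes M: "right_module R M" and N: "right_module R N" and "fin_gen R M" "fin_gen R N"
  shows "fin_gen R (direct_sum M N)"
proof -
  interpret M: right_module R M by (rule M)
  interpret N: right_module R N by (rule N)
  interpret S: right_module R "direct_sum M N" by (rule right_module_direct_sum[OF M N])
  from assms(3) obtain m :: nat and x where x: "x \<in> {..<m} \<rightarrow> carrier M"
    and genx: "\<And>p. p \<in> carrier M \<Longrightarrow> \<exists>c \<in> {..<m} \<rightarrow> carrier R. p = (\<Oplus>\<^bsub>M\<^esub>i\<in>{..<m}. x i \<triangleleft>\<^bsub>M\<^esub> c i)"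
    unfolding fin_gen_def by blast
  from assms(4) obtain n :: nat and y where y: "y \<in> {..<n} \<rightarrow> carrier N"
    and geny: "\<And>p. p \<in> carrier N \<Longrightarrow> \<exists>c \<in> {..<n} \<rightarrow> carrier R. p = (\<Oplus>\<^bsub>N\<^esub>i\<in>{..<n}. y i \<triangleleft>\<^bsub>N\<^esub> c i)"
    unfolding fin_gen_def by blast
  define z where "z i = (if i < m then (x i, \<zero>\<^bsub>N\<^esub>) else (\<zero>\<^bsub>M\<^esub>, y (i - m)))" for i
  have sum: "(\<Oplus>\<^bsub>direct_sum M N\<^esub>i\<in>{..<m + k}. z i \<triangleleft>\<^bsub>direct_sum M N\<^esub> (if i < m then c i else d (i - m))) =
      ((\<Oplus>\<^bsub>M\<^esub>i\<in>{..<m}. x i \<triangleleft>\<^bsub>M\<^esub> c i), (\<Oplus>\<^bsub>N\<^esub>i\<in>{..<k}. y i \<triangleleft>\<^bsub>N\<^esub> d i))"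
    if c: "c \<in> {..<m} \<rightarrow> carrier R" and d: "d \<in> {..<n} \<rightarrow> carrier R" and k: "k \<le> n" for c d k
    using k
  proof (induction k)
    case 0
    have hom: "(\<lambda>p. (p, \<zero>\<^bsub>N\<^esub>)) \<in> rmod_hom R M (direct_sum M N)"
      by (rule rmod_homI) auto
    have "(\<Oplus>\<^bsub>direct_sum M N\<^esub>i\<in>{..<m}. z i \<triangleleft>\<^bsub>direct_sum M N\<^esub> (if i < m then c i else d (i - m))) =
      (\<Oplus>\<^bsub>direct_sum M N\<^esub>i\<in>{..<m}. (x i, \<zero>\<^bsub>N\<^esub>) \<triangleleft>\<^bsub>direct_sum M N\<^esub> c i)"
      by (rule S.M.finsum_cong') (use x c in \<open>auto simp: z_def\<close>)
    also have "\<dots> = ((\<Oplus>\<^bsub>M\<^esub>i\<in>{..<m}. x i \<triangleleft>\<^bsub>M\<^esub> c i), \<zero>\<^bsub>N\<^esub>)"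
      by (rule rmod_hom_lincomb[OF M S.right_module_self hom x c, symmetric])
    finally show ?case by simp
  next
    case (Suc k)
    have yk: "y k \<triangleleft>\<^bsub>N\<^esub> d k \<in> carrier N" "(\<lambda>i. y i \<triangleleft>\<^bsub>N\<^esub> d i) \<in> {..<k} \<rightarrow> carrier N"
      and dk: "d k \<in> carrier R"
      using Suc.prems y d by (auto simp: Pi_iff)
    have zz: "(\<lambda>i. z i \<triangleleft>\<^bsub>direct_sum M N\<^esub> (if i < m then c i else d (i - m))) \<in> {..<m + k} \<rightarrow> carrier M \<times> carrier N"
      using Suc.prems x y c d by (auto simp: z_def Pi_iff)
    have mc: "(\<Oplus>\<^bsub>M\<^esub>i\<in>{..<m}. x i \<triangleleft>\<^bsub>M\<^esub> c i) \<in> carrier M"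
      by (rule M.M.finsum_closed) (use x c in auto)
    have "(\<Oplus>\<^bsub>direct_sum M N\<^esub>i\<in>{..<m + Suc k}. z i \<triangleleft>\<^bsub>direct_sum M N\<^esub> (if i < m then c i else d (i - m))) =
        (\<zero>\<^bsub>M\<^esub>, y k \<triangleleft>\<^bsub>N\<^esub> d k) \<oplus>\<^bsub>direct_sum M N\<^esub>
        ((\<Oplus>\<^bsub>M\<^esub>i\<in>{..<m}. x i \<triangleleft>\<^bsub>M\<^esub> c i), (\<Oplus>\<^bsub>N\<^esub>i\<in>{..<k}. y i \<triangleleft>\<^bsub>N\<^esub> d i))"
      using Suc.IH Suc.prems zz yk dk
      by (simp add: lessThan_Suc S.M.finsum_insert z_def)
    then show ?case using mc yk by (simp add: lessThan_Suc)
  qed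
  show ?thesis unfolding fin_gen_def
  proof (intro exI[of _ "m + n"] bexI[of _ z] ballI)
    show "z \<in> {..<m + n} \<rightarrow> carrier (direct_sum M N)" using x y by (auto simp: z_def Pi_iff)
    fix p assume "p \<in> carrier (direct_sum M N)"
    then obtain u v where p: "p = (u, v)" "u \<in> carrier M" "v \<in> carrier N" by auto
    from genx[OF p(2)] geny[OF p(3)] obtain c d where
      c: "c \<in> {..<m} \<rightarrow> carrier R" "u = (\<Oplus>\<^bsub>M\<^esub>i\<in>{..<m}. x i \<triangleleft>\<^bsub>M\<^esub> c i)" and
      d: "d \<in> {..<n} \<rightarrow> carrier R" "v = (\<Oplus>\<^bsub>N\<^esub>i\<in>{..<n}. y i \<triangleleft>\<^bsub>N\<^esub> d i)" by blast
    have "(\<lambda>i. if i < m then c i else d (i - m)) \<in> {..<m + n} \<rightarrow> carrier R"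
      using c(1) d(1) by (auto simp: Pi_iff)
    then show "\<exists>c \<in> {..<m + n} \<rightarrow> carrier R.
        p = (\<Oplus>\<^bsub>direct_sum M N\<^esub>i\<in>{..<m + n}. z i \<triangleleft>\<^bsub>direct_sum M N\<^esub> c i)"
      using sum[OF c(1) d(1) order_refl] p(1) c(2) d(2) by (intro bexI) auto
  qed
qed

lemma projective_direct_sum:
  assumes M: "right_module R M" and N: "right_module R N" and pM: "projective R M" and pN: "projective R N"
  shows "projective R (direct_sum M N)"
  unfolding projective_def
proof (intro allI impI)
  fix B C :: "('a, nat \<Rightarrow> 'a) rmodule" and g h
  assume BC: "right_module R B" "right_module R C" "g \<in> rmod_hom R B C"
    "g ` carrier B = carrier C" and h: "h \<in> rmod_hom R (direct_sum M N) C"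
  interpret M: right_module R M by (rule M)
  interpret N: right_module R N by (rule N)
  interpret B: right_module R B by (rule BC)
  have 1: "(\<lambda>x. (x, \<zero>\<^bsub>N\<^esub>)) \<in> rmod_hom R M (direct_sum M N)" by (rule rmod_homI) auto
  have 2: "(\<lambda>y. (\<zero>\<^bsub>M\<^esub>, y)) \<in> rmod_hom R N (direct_sum M N)" by (rule rmod_homI) auto
  obtain k where k: "k \<in> rmod_hom R M B" "\<And>x. x \<in> carrier M \<Longrightarrow> g (k x) = h (x, \<zero>\<^bsub>N\<^esub>)"
    using projectiveD[OF pM BC rmod_hom_comp[OF 1 h]] by blast
  obtain l where l: "l \<in> rmod_hom R N B" "\<And>y. y \<in> carrier N \<Longrightarrow> g (l y) = h (\<zero>\<^bsub>M\<^esub>, y)"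
    using projectiveD[OF pN BC rmod_hom_comp[OF 2 h]] by blast
  note kl = rmod_hom_simps[OF k(1)] rmod_hom_simps[OF l(1)]
  have "(\<lambda>(x, y). k x \<oplus>\<^bsub>B\<^esub> l y) \<in> rmod_hom R (direct_sum M N) B"
    by (rule rmod_homI) (auto simp: kl B.ract_add_left B.M.a_ac)
  moreover have "g (k x \<oplus>\<^bsub>B\<^esub> l y) = h (x, y)" if "x \<in> carrier M" "y \<in> carrier N" for x y
    using that rmod_hom_add[OF h, of "(x, \<zero>\<^bsub>N\<^esub>)" "(\<zero>\<^bsub>M\<^esub>, y)"] by (simp add: rmod_hom_add[OF BC(3)] kl k(2) l(2))
  ultimately show "\<exists>k\<in>rmod_hom R (direct_sum M N) B. \<forall>p\<in>carrier (direct_sum M N). g (k p) = h p"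
    by (intro bexI) auto
qed

lemma fg_projective_direct_sum:
  "\<lbrakk>fg_projective R M; fg_projective R N\<rbrakk> \<Longrightarrow> fg_projective R (direct_sum M N)"
  by (simp add: fg_projective_def right_module_direct_sum fin_gen_direct_sum projective_direct_sum)

lemma direct_sum_cong:
  assumes M: "right_module R M" and N: "right_module R N"
    and "rmod_iso R M M'" "rmod_iso R N N'"
  shows "rmod_iso R (direct_sum M N) (direct_sum M' N')"
proof -
  obtain f g where fg: "f \<in> rmod_hom R M M'" "g \<in> rmod_hom R M' M"
    "\<And>x. x \<in> carrier M \<Longrightarrow> g (f x) = x" "\<And>y. y \<in> carrier M' \<Longrightarrow> f (g y) = y"
    using rmod_isoE[OF M assms(3)] by metis
  obtain f' g' where fg': "f' \<in> rmod_hom R N N'" "g' \<in> rmod_hom R N' N"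
    "\<And>x. x \<in> carrier N \<Longrightarrow> g' (f' x) = x" "\<And>y. y \<in> carrier N' \<Longrightarrow> f' (g' y) = y"
    using rmod_isoE[OF N assms(4)] by metis
  show ?thesis
    by (rule rmod_isoI[where f = "map_prod f f'" and g = "map_prod g g'"])
      (use fg fg' in \<open>auto intro!: rmod_homI simp: rmod_hom_simps\<close>)
qed

lemma direct_sum_assoc:
  "rmod_iso R (direct_sum (direct_sum M N) P) (direct_sum M (direct_sum N P))"
  by (rule rmod_isoI[where f = "\<lambda>((x, y), z). (x, (y, z))" and g = "\<lambda>(x, (y, z)). ((x, y), z)"])
    (auto intro!: rmod_homI)

lemma direct_sum_comm: "rmod_iso R (direct_sum M N) (direct_sum N M)"
  by (rule rmod_isoI[where f = "\<lambda>(x, y). (y, x)" and g = "\<lambda>(x, y). (y, x)"]) (auto intro!: rmod_homI)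

lemma zero_rmodule_simps [simp]:
  "carrier zero_rmodule = {()}" "\<zero>\<^bsub>zero_rmodule\<^esub> = ()"
  "x \<oplus>\<^bsub>zero_rmodule\<^esub> y = ()" "x \<triangleleft>\<^bsub>zero_rmodule\<^esub> a = ()"
  by (simp_all add: zero_rmodule_def)

lemma direct_sum_zero: "rmod_iso R (direct_sum zero_rmodule M) M"
  by (rule rmod_isoI[where f = snd and g = "\<lambda>x. ((), x)"]) (auto intro!: rmod_homI)

lemma fg_projective_zero:
  assumes "ring R" shows "fg_projective R (zero_rmodule :: ('a, unit) rmodule)"
proof -
  interpret ring R by (rule assms)
  have "abelian_group (zero_rmodule :: ('a, unit) rmodule)" by (rule abelian_groupI) auto
  then have Z: "right_module R (zero_rmodule :: ('a, unit) rmodule)"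
    by (intro right_moduleI) (auto simp: assms)
  have "fin_gen R (zero_rmodule :: ('a, unit) rmodule)"
    unfolding fin_gen_def by (intro exI[of _ 0]) auto
  moreover have "projective R (zero_rmodule :: ('a, unit) rmodule)"
    unfolding projective_def
  proof (intro allI impI)
    fix B C :: "('a, nat \<Rightarrow> 'a) rmodule" and g h
    assume BC: "right_module R B" "right_module R C" "g \<in> rmod_hom R B C"
      and h: "h \<in> rmod_hom R (zero_rmodule :: ('a, unit) rmodule) C"
    interpret B: right_module R B by (rule BC)
    interpret C: right_module R C by (rule BC)
    have gz: "g \<zero>\<^bsub>B\<^esub> = \<zero>\<^bsub>C\<^esub>"
      using rmod_hom_add[OF BC(3), of "\<zero>\<^bsub>B\<^esub>" "\<zero>\<^bsub>B\<^esub>"] rmod_hom_closed[OF BC(3), of "\<zero>\<^bsub>B\<^esub>"]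
      by (simp add: C.M.add.l_cancel_one')
    have hz: "h () = \<zero>\<^bsub>C\<^esub>"
      using rmod_hom_add[OF h, of "()" "()"] rmod_hom_closed[OF h, of "()"] by (simp add: C.M.add.l_cancel_one')
    have "(\<lambda>_. \<zero>\<^bsub>B\<^esub>) \<in> rmod_hom R (zero_rmodule :: ('a, unit) rmodule) B" by (rule rmod_homI) auto
    then show "\<exists>k\<in>rmod_hom R (zero_rmodule :: ('a, unit) rmodule) B. \<forall>p\<in>carrier zero_rmodule. g (k p) = h p"
      using gz hz by (intro bexI[of _ "\<lambda>_. \<zero>\<^bsub>B\<^esub>"]) auto
  qed
  ultimately show ?thesis using Z by (simp add: fg_projective_def)
qed

lemma regular_rmodule_simps [simp]:
  "carrier (regular_rmodule R) = carrier R" "\<zero>\<^bsub>regular_rmodule R\<^esub> = \<zero>\<^bsub>R\<^esub>"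
  "x \<oplus>\<^bsub>regular_rmodule R\<^esub> y = x \<oplus>\<^bsub>R\<^esub> y" "x \<triangleleft>\<^bsub>regular_rmodule R\<^esub> a = x \<otimes>\<^bsub>R\<^esub> a"
  by (simp_all add: regular_rmodule_def)

lemma fg_projective_regular:
  assumes "ring R" shows "fg_projective R (regular_rmodule R)"
proof -
  interpret ring R by (rule assms)
  have "abelian_group (regular_rmodule R)"
  proof (rule abelian_groupI)
    fix x assume "x \<in> carrier (regular_rmodule R)"
    then show "\<exists>y\<in>carrier (regular_rmodule R). y \<oplus>\<^bsub>regular_rmodule R\<^esub> x = \<zero>\<^bsub>regular_rmodule R\<^esub>"
      by (intro bexI[of _ "\<ominus>\<^bsub>R\<^esub> x"]) (simp_all add: l_neg)
  qed (auto simp: a_ac)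
  then have rr: "right_module R (regular_rmodule R)"
    by (intro right_moduleI) (auto simp: assms m_assoc l_distr r_distr)
  interpret S: right_module R "regular_rmodule R" by (rule rr)
  have "fin_gen R (regular_rmodule R)"
    unfolding fin_gen_def
  proof (rule exI[of _ 1], rule bexI[of _ "\<lambda>_. \<one>\<^bsub>R\<^esub>"], rule ballI)
    fix m assume "m \<in> carrier (regular_rmodule R)"
    then show "\<exists>c\<in>{..<1::nat} \<rightarrow> carrier R. m = (\<Oplus>\<^bsub>regular_rmodule R\<^esub>i\<in>{..<1}. \<one>\<^bsub>R\<^esub> \<triangleleft>\<^bsub>regular_rmodule R\<^esub> c i)"
      using S.M.finsum_insert[of "{}" "0::nat" "\<lambda>_. m"]
      by (intro bexI[of _ "\<lambda>_. m"]) (simp_all add: lessThan_Suc)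
  qed auto
  moreover have "projective R (regular_rmodule R)"
    unfolding projective_def
  proof (intro allI impI)
    fix B C :: "('a, nat \<Rightarrow> 'a) rmodule" and g h
    assume BC: "right_module R B" "right_module R C" "g \<in> rmod_hom R B C" "g ` carrier B = carrier C"
      and h: "h \<in> rmod_hom R (regular_rmodule R) C"
    interpret B: right_module R B by (rule BC)
    obtain b where b: "b \<in> carrier B" "g b = h \<one>\<^bsub>R\<^esub>"
      using rmod_hom_closed[OF h, of "\<one>\<^bsub>R\<^esub>"] unfolding BC(4)[symmetric] by auto
    have "(\<lambda>a. b \<triangleleft>\<^bsub>B\<^esub> a) \<in> rmod_hom R (regular_rmodule R) B"
      using b(1) by (intro rmod_homI) (auto simp: B.ract_add_right B.ract_assoc)
    moreover have "g (b \<triangleleft>\<^bsub>B\<^esub> a) = h a" if "a \<in> carrier R" for a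
      using that b rmod_hom_ract[OF h, of "\<one>\<^bsub>R\<^esub>" a] by (simp add: rmod_hom_ract[OF BC(3)])
    ultimately show "\<exists>k\<in>rmod_hom R (regular_rmodule R) B. \<forall>p\<in>carrier (regular_rmodule R). g (k p) = h p"
      by (intro bexI) auto
  qed
  ultimately show ?thesis using rr by (simp add: fg_projective_def)
qed

subsection \<open>The monoids \<open>VR\<close> and \<open>UR\<close>, and the induced homomorphism\<close>

lemma fg_projectiveD: "fg_projective R M \<Longrightarrow> right_module R M"
  by (simp add: fg_projective_def)

lemma in_iso_class: "P \<in> iso_class R M \<longleftrightarrow> fg_projective R P \<and> rmod_iso R P M"
  by (simp add: iso_class_def)

lemma iso_class_eq_iff:
  assumes M: "fg_projective R M"
  shows "iso_class R M = iso_class R N \<longleftrightarrow> rmod_iso R M N"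
proof
  assume eq: "iso_class R M = iso_class R N"
  obtain P :: "('a, nat \<Rightarrow> 'a) rmodule" where P: "fg_projective R P" "rmod_iso R P M"
    using fg_projective_copy[OF M] by blast
  then have "P \<in> iso_class R N" by (simp add: eq[symmetric] in_iso_class)
  then have "rmod_iso R P N" by (simp add: in_iso_class)
  with rmod_iso_sym[OF fg_projectiveD[OF P(1)] P(2)] show "rmod_iso R M N" by (rule rmod_iso_trans)
next
  assume iso: "rmod_iso R M N"
  show "iso_class R M = iso_class R N"
  proof (rule Set.set_eqI)
    fix P show "P \<in> iso_class R M \<longleftrightarrow> P \<in> iso_class R N"
      unfolding in_iso_class
      using rmod_iso_trans[OF _ iso, of P] rmod_iso_trans[OF _ rmod_iso_sym[OF fg_projectiveD[OF M] iso], of P]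
      by meson
  qed
qed

lemma iso_class_in_VR:
  fixes M :: "('a, 'm, 'x) rmodule_scheme"
  assumes M: "fg_projective R M" shows "iso_class R M \<in> carrier (VR R)"
proof -
  obtain P :: "('a, nat \<Rightarrow> 'a) rmodule" where P: "fg_projective R P" "rmod_iso R P M"
    using fg_projective_copy[OF M] by blast
  then have "iso_class R P = iso_class R M" by (simp add: iso_class_eq_iff)
  then have "iso_class R M = iso_class R P" ..
  with P(1) show ?thesis by (auto simp: VR_def)
qed

lemma VR_carrierE:
  assumes "X \<in> carrier (VR R)"
  obtains P :: "('a, nat \<Rightarrow> 'a) rmodule" where "fg_projective R P" "X = iso_class R P"
  using assms by (auto simp: VR_def)

lemma VR_mult:
  fixes M :: "('a, 'm, 'x) rmodule_scheme" and N :: "('a, 'n, 'y) rmodule_scheme"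
  assumes M: "fg_projective R M" and N: "fg_projective R N"
  shows "iso_class R M \<otimes>\<^bsub>VR R\<^esub> iso_class R N = iso_class R (direct_sum M N)"
proof (rule Set.set_eqI)
  fix X :: "('a, nat \<Rightarrow> 'a) rmodule"
  obtain P :: "('a, nat \<Rightarrow> 'a) rmodule" where P: "fg_projective R P" "rmod_iso R P M"
    using fg_projective_copy[OF M] by blast
  obtain Q :: "('a, nat \<Rightarrow> 'a) rmodule" where Q: "fg_projective R Q" "rmod_iso R Q N"
    using fg_projective_copy[OF N] by blast
  have PQ: "rmod_iso R (direct_sum M N) (direct_sum P Q)"
    by (rule direct_sum_cong[OF fg_projectiveD[OF M] fg_projectiveD[OF N]
        rmod_iso_sym[OF fg_projectiveD[OF P(1)] P(2)] rmod_iso_sym[OF fg_projectiveD[OF Q(1)] Q(2)]])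
  have mult: "X \<in> iso_class R M \<otimes>\<^bsub>VR R\<^esub> iso_class R N \<longleftrightarrow>
      fg_projective R X \<and> (\<exists>P\<in>iso_class R M. \<exists>Q\<in>iso_class R N. rmod_iso R X (direct_sum P Q))"
    by (simp add: VR_def)
  show "X \<in> iso_class R M \<otimes>\<^bsub>VR R\<^esub> iso_class R N \<longleftrightarrow> X \<in> iso_class R (direct_sum M N)"
  proof
    assume "X \<in> iso_class R M \<otimes>\<^bsub>VR R\<^esub> iso_class R N"
    then obtain P' Q' :: "('a, nat \<Rightarrow> 'a) rmodule" where X: "fg_projective R X" "rmod_iso R X (direct_sum P' Q')"
      and P': "fg_projective R P'" "rmod_iso R P' M" and Q': "fg_projective R Q'" "rmod_iso R Q' N"
      unfolding mult by (elim conjE bexE) (simp add: in_iso_class)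
    have "rmod_iso R (direct_sum P' Q') (direct_sum M N)"
      by (rule direct_sum_cong[OF fg_projectiveD[OF P'(1)] fg_projectiveD[OF Q'(1)] P'(2) Q'(2)])
    with X show "X \<in> iso_class R (direct_sum M N)"
      unfolding in_iso_class using rmod_iso_trans[OF X(2)] by simp
  next
    assume "X \<in> iso_class R (direct_sum M N)"
    then have "fg_projective R X" "rmod_iso R X (direct_sum P Q)"
      using rmod_iso_trans[OF _ PQ, of X] by (simp_all add: in_iso_class)
    moreover have "P \<in> iso_class R M" "Q \<in> iso_class R N" using P Q by (simp_all add: in_iso_class)
    ultimately show "X \<in> iso_class R M \<otimes>\<^bsub>VR R\<^esub> iso_class R N" unfolding mult by auto
  qed
qed

lemma VR_one: "\<one>\<^bsub>VR R\<^esub> = iso_class R (zero_rmodule :: ('a, unit) rmodule)"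
  for R :: "('a, 'r) ring_scheme"
  by (simp add: VR_def)

theorem comm_monoid_VR:
  assumes R: "ring R" shows "comm_monoid (VR R)"
proof (rule comm_monoidI)
  fix X Y assume XY: "X \<in> carrier (VR R)" "Y \<in> carrier (VR R)"
  show "X \<otimes>\<^bsub>VR R\<^esub> Y \<in> carrier (VR R)"
    using XY by (elim VR_carrierE) (simp add: VR_mult iso_class_in_VR fg_projective_direct_sum)
  show "X \<otimes>\<^bsub>VR R\<^esub> Y = Y \<otimes>\<^bsub>VR R\<^esub> X"
    using XY by (elim VR_carrierE)
      (simp add: VR_mult fg_projective_direct_sum iso_class_eq_iff direct_sum_comm)
next
  fix X Y Z assume "X \<in> carrier (VR R)" "Y \<in> carrier (VR R)" "Z \<in> carrier (VR R)"
  then show "X \<otimes>\<^bsub>VR R\<^esub> Y \<otimes>\<^bsub>VR R\<^esub> Z = X \<otimes>\<^bsub>VR R\<^esub> (Y \<otimes>\<^bsub>VR R\<^esub> Z)"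
    by (elim VR_carrierE)
      (simp_all add: VR_mult fg_projective_direct_sum iso_class_eq_iff direct_sum_assoc)
next
  show "\<one>\<^bsub>VR R\<^esub> \<in> carrier (VR R)"
    by (simp add: VR_one iso_class_in_VR fg_projective_zero R)
next
  fix X assume "X \<in> carrier (VR R)"
  then show "\<one>\<^bsub>VR R\<^esub> \<otimes>\<^bsub>VR R\<^esub> X = X"
    by (elim VR_carrierE)
      (simp_all add: VR_one VR_mult fg_projective_direct_sum fg_projective_zero R iso_class_eq_iff direct_sum_zero)
qed

lemma comm_monoid_UR:
  assumes "ring R" shows "comm_monoid (UR R)"
  unfolding UR_def
  by (intro comm_monoid.cyclic_submonoid_comm_monoid comm_monoid_VR iso_class_in_VR
      fg_projective_regular assms)

lemma UR_inclusion_hom: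
  assumes "ring R" shows "(\<lambda>X. X) \<in> hom (UR R) (VR R)"
proof (rule homI)
  fix X assume X: "X \<in> carrier (UR R)"
  have "submonoid (carrier (UR R)) (VR R)"
    unfolding UR_def
    by (intro comm_monoid.cyclic_submonoid_least comm_monoid_VR iso_class_in_VR
        fg_projective_regular assms)
  then show "X \<in> carrier (VR R)" using X by (rule submonoid.mem_carrier)
qed (simp add: UR_def cyclic_submonoid_def)

lemma comm_group_K0:
  assumes "ring R" shows "comm_group (K0 R)"
  unfolding K0_def
  by (intro comm_semigp.comm_group_groth comm_monoid_is_comm_semigp comm_monoid_VR assms)

lemma groth_map_inclusion_hom:
  assumes "ring R" shows "groth_map (UR R) (VR R) (\<lambda>X. X) \<in> hom (groth (UR R)) (K0 R)"
  unfolding K0_def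
  by (intro groth_map_hom comm_monoid_is_comm_semigp comm_monoid_UR comm_monoid_VR UR_inclusion_hom assms)

end

theory Submission
  imports Defs
begin

text \<open>
  Two elements of a commutative semigroup become equal in its Grothendieck group exactly if they
  become equal after adding a common summand.  Passing from \<open>\<U>(R)\<close> to \<open>\<V>(R)\<close> enlarges the supply of
  such summands, so that new equations could appear; injectivity says that none do.  The reason is
  that \<open>\<U>(R)\<close> is cofinal in \<open>\<V>(R)\<close>: a finitely generated projective module \<open>P\<close> is a direct summand
  of some \<open>R\<^sup>n\<close>, say \<open>P \<oplus> Q \<cong> R\<^sup>n\<close> with \<open>Q\<close> again finitely generated projective.  Hence from
  \<open>a + [P] = b + [P]\<close> one obtains \<open>a + n[R] = b + n[R]\<close> by adding \<open>[Q]\<close>, and this is an equation with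
  a summand in \<open>\<U>(R)\<close>.

  The argument about semigroups is \<open>groth_map_mon_of_cofinal\<close>.  Cofinality combines
  \<open>fg_projective_complement\<close>, which splits \<open>R\<^sup>n\<close> as \<open>P\<close> plus the kernel of a projection onto \<open>P\<close>,
  with \<open>VR_pow_regular\<close>, which identifies the multiples of \<open>[R]\<close> with the classes of the modules
  \<open>R\<^sup>n\<close>.
\<close>

section \<open>Cofinal subsemigroups\<close>

text \<open>
  An equation \<open>f a + f d + t = f c + f b + t\<close> may be enlarged by a complement of \<open>t\<close>; the summand then
  lies in the image of \<open>f\<close>, and injectivity of \<open>f\<close> pulls the whole equation back to \<open>S\<close>.
\<close>

lemma groth_map_mon_of_cofinal:
  assumes S: "comm_semigp S" and T: "comm_semigp T"
    and f: "f \<in> hom S T" and inj: "inj_on f (carrier S)"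
    and cofinal: "\<And>t. t \<in> carrier T \<Longrightarrow> \<exists>t'\<in>carrier T. \<exists>s\<in>carrier S. t \<otimes>\<^bsub>T\<^esub> t' = f s"
  shows "groth_map S T f \<in> mon (groth S) (groth T)"
proof -
  interpret S: comm_semigp S by (rule S)
  interpret T: comm_semigp T by (rule T)
  have fc: "f a \<in> carrier T" if "a \<in> carrier S" for a using f that by (rule hom_in_carrier)
  have "inj_on (groth_map S T f) (carrier (groth S))"
  proof (rule inj_onI, elim S.groth_carrierE)
    fix X Y a b c d
    assume eq: "groth_map S T f X = groth_map S T f Y"
      and ab: "a \<in> carrier S" "b \<in> carrier S" and X: "X = groth_class S a b"
      and cd: "c \<in> carrier S" "d \<in> carrier S" and Y: "Y = groth_class S c d"
    have "groth_class T (f a) (f b) = groth_class T (f c) (f d)"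
      using eq by (simp add: X Y groth_map_class[OF S T f] ab cd)
    then obtain t where t: "t \<in> carrier T" "f a \<otimes>\<^bsub>T\<^esub> f d \<otimes>\<^bsub>T\<^esub> t = f c \<otimes>\<^bsub>T\<^esub> f b \<otimes>\<^bsub>T\<^esub> t"
      using ab cd by (auto simp: T.groth_class_eq_iff fc)
    obtain t' s where s: "t' \<in> carrier T" "s \<in> carrier S" "t \<otimes>\<^bsub>T\<^esub> t' = f s"
      using cofinal[OF t(1)] by blast
    have "f (a \<otimes>\<^bsub>S\<^esub> d \<otimes>\<^bsub>S\<^esub> s) = f a \<otimes>\<^bsub>T\<^esub> f d \<otimes>\<^bsub>T\<^esub> t \<otimes>\<^bsub>T\<^esub> t'"
      using ab cd s(1,2) t(1) by (simp add: hom_mult[OF f] s(3)[symmetric] fc T.assoc)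
    also have "\<dots> = f (c \<otimes>\<^bsub>S\<^esub> b \<otimes>\<^bsub>S\<^esub> s)"
      unfolding t(2) using ab cd s(1,2) t(1)
      by (simp add: hom_mult[OF f] s(3)[symmetric] fc T.assoc)
    finally have "a \<otimes>\<^bsub>S\<^esub> d \<otimes>\<^bsub>S\<^esub> s = c \<otimes>\<^bsub>S\<^esub> b \<otimes>\<^bsub>S\<^esub> s"
      by (rule inj_onD[OF inj]) (use ab cd s(2) in auto)
    then show "X = Y"
      unfolding X Y using ab cd s(2) by (auto simp: S.groth_class_eq_iff)
  qed
  with groth_map_hom[OF S T f] show ?thesis by (simp add: mon_def)
qed

section \<open>Retracts and split surjections\<close>

lemma rmod_hom_zero:
  assumes M: "right_module R M" and N: "right_module R N" and f: "f \<in> rmod_hom R M N"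
  shows "f \<zero>\<^bsub>M\<^esub> = \<zero>\<^bsub>N\<^esub>"
proof -
  interpret M: right_module R M by (rule M)
  interpret N: right_module R N by (rule N)
  show ?thesis
    using rmod_hom_add[OF f, of "\<zero>\<^bsub>M\<^esub>" "\<zero>\<^bsub>M\<^esub>"] rmod_hom_closed[OF f, of "\<zero>\<^bsub>M\<^esub>"]
    by (simp add: N.M.add.l_cancel_one')
qed

lemma rmod_hom_minus:
  assumes M: "right_module R M" and N: "right_module R N" and f: "f \<in> rmod_hom R M N"
    and x: "x \<in> carrier M"
  shows "f (\<ominus>\<^bsub>M\<^esub> x) = \<ominus>\<^bsub>N\<^esub> f x"
proof -
  interpret M: right_module R M by (rule M)
  interpret N: right_module R N by (rule N)
  have "f (\<ominus>\<^bsub>M\<^esub> x) \<oplus>\<^bsub>N\<^esub> f x = \<zero>\<^bsub>N\<^esub>"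
    using x by (simp add: rmod_hom_add[OF f, symmetric] M.M.l_neg rmod_hom_zero[OF M N f])
  then show ?thesis
    using x by (simp add: N.M.minus_equality rmod_hom_closed[OF f])
qed

text \<open>A lifting problem for a retract \<open>N\<close> of \<open>M\<close> is solved by restricting a solution for \<open>M\<close>.\<close>

lemma fg_projective_retract:
  assumes M: "fg_projective R M" and N: "right_module R N"
    and r: "r \<in> rmod_hom R M N" and i: "i \<in> rmod_hom R N M"
    and ri: "\<And>y. y \<in> carrier N \<Longrightarrow> r (i y) = y"
  shows "fg_projective R N"
proof -
  have M': "right_module R M" "fin_gen R M" "projective R M"
    using M by (simp_all add: fg_projective_def)
  have "carrier N \<subseteq> r ` carrier M"
  proof
    fix y assume y: "y \<in> carrier N"
    show "y \<in> r ` carrier M"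
      by (rule image_eqI[of _ _ "i y"]) (simp_all add: y ri rmod_hom_closed[OF i])
  qed
  then have surj: "r ` carrier M = carrier N" by (auto simp: rmod_hom_closed[OF r])
  have "projective R N"
    unfolding projective_def
  proof (intro allI impI)
    fix B C :: "('a, nat \<Rightarrow> 'a) rmodule" and g h
    assume BC: "right_module R B" "right_module R C" "g \<in> rmod_hom R B C"
      "g ` carrier B = carrier C" and h: "h \<in> rmod_hom R N C"
    obtain k where k: "k \<in> rmod_hom R M B" "\<forall>x\<in>carrier M. g (k x) = h (r x)"
      using projectiveD[OF M'(3) BC rmod_hom_comp[OF r h]] ..
    then show "\<exists>k\<in>rmod_hom R N B. \<forall>y\<in>carrier N. g (k y) = h y"
      by (intro bexI[OF _ rmod_hom_comp[OF i k(1)]]) (simp add: rmod_hom_closed[OF i] ri)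
  qed
  then show ?thesis
    using N fin_gen_image[OF M'(1) N r surj M'(2)] by (simp add: fg_projective_def)
qed

definition kernel_rmodule ::
  "('a, 'm) rmodule \<Rightarrow> ('a, 'n, 'y) rmodule_scheme \<Rightarrow> ('m \<Rightarrow> 'n) \<Rightarrow> ('a, 'm) rmodule"
  where "kernel_rmodule M N f = M\<lparr>carrier := {x \<in> carrier M. f x = \<zero>\<^bsub>N\<^esub>}\<rparr>"

lemma kernel_rmodule_simps [simp]:
  "x \<in> carrier (kernel_rmodule M N f) \<longleftrightarrow> x \<in> carrier M \<and> f x = \<zero>\<^bsub>N\<^esub>"
  "\<zero>\<^bsub>kernel_rmodule M N f\<^esub> = \<zero>\<^bsub>M\<^esub>"
  "x \<oplus>\<^bsub>kernel_rmodule M N f\<^esub> y = x \<oplus>\<^bsub>M\<^esub> y"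
  "x \<triangleleft>\<^bsub>kernel_rmodule M N f\<^esub> a = x \<triangleleft>\<^bsub>M\<^esub> a"
  by (simp_all add: kernel_rmodule_def)

lemma right_module_kernel:
  assumes M: "right_module R M" and N: "right_module R N" and f: "f \<in> rmod_hom R M N"
  shows "right_module R (kernel_rmodule M N f)"
proof -
  interpret M: right_module R M by (rule M)
  interpret N: right_module R N by (rule N)
  note fs = rmod_hom_add[OF f] rmod_hom_ract[OF f] rmod_hom_zero[OF M N f] rmod_hom_minus[OF M N f]
  have "abelian_group (kernel_rmodule M N f)"
  proof (rule abelian_groupI)
    fix x assume "x \<in> carrier (kernel_rmodule M N f)"
    then show "\<exists>y\<in>carrier (kernel_rmodule M N f). y \<oplus>\<^bsub>kernel_rmodule M N f\<^esub> x = \<zero>\<^bsub>kernel_rmodule M N f\<^esub>"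
      by (intro bexI[of _ "\<ominus>\<^bsub>M\<^esub> x"]) (simp_all add: M.M.l_neg fs)
  qed (auto simp: fs M.M.a_ac)
  then show ?thesis
    by (intro right_moduleI)
      (auto simp: fs M.R.ring_axioms M.ract_add_right M.ract_add_left M.ract_assoc)
qed

text \<open>
  For a section \<open>s\<close> of \<open>g\<close>, the element \<open>x - s (g x)\<close> lies in the kernel of \<open>g\<close> for every \<open>x\<close>, and
  equals \<open>x\<close> if \<open>x\<close> is in the kernel already.  So this map is a retraction onto the kernel, and
  together with \<open>g\<close> it decomposes \<open>M\<close>.
\<close>

lemma split_surjection_kernel:
  assumes M: "fg_projective R M" and N: "right_module R N"
    and g: "g \<in> rmod_hom R M N" and s: "s \<in> rmod_hom R N M"
    and gs: "\<And>y. y \<in> carrier N \<Longrightarrow> g (s y) = y"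
  shows "fg_projective R (kernel_rmodule M N g)"
    and "rmod_iso R (direct_sum N (kernel_rmodule M N g)) M"
proof -
  let ?K = "kernel_rmodule M N g"
  have rM: "right_module R M" using M by (rule fg_projectiveD)
  interpret M: right_module R M by (rule rM)
  interpret N: right_module R N by (rule N)
  have K: "right_module R ?K" using rM N g by (rule right_module_kernel)
  note gc = rmod_hom_simps[OF g] rmod_hom_minus[OF rM N g]
  note sc = rmod_hom_simps[OF s]
  define e where "e x = x \<oplus>\<^bsub>M\<^esub> s (\<ominus>\<^bsub>N\<^esub> g x)" for x
  have neg_ract: "(\<ominus>\<^bsub>N\<^esub> y) \<triangleleft>\<^bsub>N\<^esub> a = \<ominus>\<^bsub>N\<^esub> (y \<triangleleft>\<^bsub>N\<^esub> a)" if "y \<in> carrier N" "a \<in> carrier R" for y a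
    using that
    by (intro N.M.minus_equality[symmetric]) (simp_all add: N.ract_add_left[symmetric] N.M.l_neg)
  have e: "e \<in> rmod_hom R M ?K"
  proof (rule rmod_homI)
    show "e x \<in> carrier ?K" if "x \<in> carrier M" for x
      using that by (simp add: e_def gc sc gs N.M.r_neg)
    show "e (x \<oplus>\<^bsub>M\<^esub> y) = e x \<oplus>\<^bsub>?K\<^esub> e y" if "x \<in> carrier M" "y \<in> carrier M" for x y
      using that by (simp add: e_def gc sc N.M.minus_add M.M.a_ac)
    show "e (x \<triangleleft>\<^bsub>M\<^esub> a) = e x \<triangleleft>\<^bsub>?K\<^esub> a" if "x \<in> carrier M" "a \<in> carrier R" for x a
      using that by (simp add: e_def gc sc M.ract_add_left neg_ract[symmetric])
  qed
  have i: "(\<lambda>x. x) \<in> rmod_hom R ?K M" by (rule rmod_homI) auto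
  have eK: "e x = x" if "x \<in> carrier ?K" for x
    using that by (simp add: e_def N.M.minus_equality[of "\<zero>\<^bsub>N\<^esub>"] rmod_hom_zero[OF N rM s])
  show "fg_projective R ?K" by (rule fg_projective_retract[OF M K e i eK])
  have ge: "s (g x) \<oplus>\<^bsub>M\<^esub> e x = x" if x: "x \<in> carrier M" for x
  proof -
    have "s (g x) \<oplus>\<^bsub>M\<^esub> e x = x \<oplus>\<^bsub>M\<^esub> s (g x \<oplus>\<^bsub>N\<^esub> \<ominus>\<^bsub>N\<^esub> g x)"
      using x by (simp add: e_def gc sc M.M.a_ac)
    also have "\<dots> = x" using x by (simp add: N.M.r_neg gc rmod_hom_zero[OF N rM s])
    finally show ?thesis .
  qed
  have es: "e (s y) = \<zero>\<^bsub>M\<^esub>" if y: "y \<in> carrier N" for y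
  proof -
    have "e (s y) = s (y \<oplus>\<^bsub>N\<^esub> \<ominus>\<^bsub>N\<^esub> y)" using y by (simp add: e_def gs sc)
    then show ?thesis using y by (simp add: N.M.r_neg rmod_hom_zero[OF N rM s])
  qed
  show "rmod_iso R (direct_sum N ?K) M"
  proof (rule rmod_isoI[where f = "\<lambda>(y, x). s y \<oplus>\<^bsub>M\<^esub> x" and g = "\<lambda>x. (g x, e x)"])
    show "(\<lambda>(y, x). s y \<oplus>\<^bsub>M\<^esub> x) \<in> rmod_hom R (direct_sum N ?K) M"
      by (rule rmod_homI) (auto simp: sc M.M.a_ac M.ract_add_left)
  next
    fix x assume x: "x \<in> carrier M"
    show "(g x, e x) \<in> carrier (direct_sum N ?K)"
      using rmod_hom_closed[OF g x] rmod_hom_closed[OF e x] by (simp del: kernel_rmodule_simps)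
    show "(\<lambda>(y, x). s y \<oplus>\<^bsub>M\<^esub> x) (g x, e x) = x" using ge[OF x] by simp
  next
    fix p assume "p \<in> carrier (direct_sum N ?K)"
    then obtain y x where p: "p = (y, x)" "y \<in> carrier N" "x \<in> carrier ?K" by auto
    then have "g (s y \<oplus>\<^bsub>M\<^esub> x) = y" by (simp add: gc sc gs)
    moreover have "e (s y \<oplus>\<^bsub>M\<^esub> x) = x"
      using p(2,3) rmod_hom_add[OF e, of "s y" x] by (simp add: es eK sc)
    ultimately show "(\<lambda>x. (g x, e x)) (case p of (y, x) \<Rightarrow> s y \<oplus>\<^bsub>M\<^esub> x) = p"
      by (simp add: p(1))
  qed
qed

section \<open>Free modules and complements\<close>

lemma free_rmodule_0_iso:
  assumes "ring R" shows "rmod_iso R zero_rmodule (free_rmodule R 0)"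
proof -
  interpret ring R by (rule assms)
  show ?thesis
    by (rule rmod_isoI[where f = "\<lambda>_ _. \<zero>\<^bsub>R\<^esub>" and g = "\<lambda>_. ()"]) (auto intro!: rmod_homI)
qed

lemma free_rmodule_Suc_iso:
  assumes "ring R"
  shows "rmod_iso R (direct_sum (free_rmodule R n) (regular_rmodule R)) (free_rmodule R (Suc n))"
proof -
  interpret ring R by (rule assms)
  show ?thesis
  proof (rule rmod_isoI[where f = "\<lambda>(v, a). v(n := a)" and g = "\<lambda>v. (v(n := \<zero>\<^bsub>R\<^esub>), v n)"])
    show "(\<lambda>(v, a). v(n := a)) \<in>
        rmod_hom R (direct_sum (free_rmodule R n) (regular_rmodule R)) (free_rmodule R (Suc n))"
      by (rule rmod_homI) (auto simp: fun_eq_iff)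
  qed (auto simp: fun_eq_iff)
qed

lemma fg_projective_free:
  assumes R: "ring R" shows "fg_projective R (free_rmodule R n)"
proof (induction n)
  case 0
  show ?case
    by (rule fg_projective_iso[OF fg_projective_zero right_module_free free_rmodule_0_iso]) (rule R)+
next
  case (Suc n)
  show ?case
    by (rule fg_projective_iso[OF fg_projective_direct_sum[OF Suc fg_projective_regular]
          right_module_free free_rmodule_Suc_iso]) (rule R)+
qed

lemma VR_pow_regular:
  fixes n :: nat
  assumes R: "ring R"
  shows "iso_class R (regular_rmodule R) [^]\<^bsub>VR R\<^esub> n = iso_class R (free_rmodule R n)"
proof (induction n)
  case 0
  have "\<one>\<^bsub>VR R\<^esub> = iso_class R (free_rmodule R 0)"
    by (simp add: VR_one iso_class_eq_iff fg_projective_zero free_rmodule_0_iso R)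
  then show ?case by (simp add: nat_pow_def)
next
  case (Suc n)
  interpret comm_monoid "VR R" by (rule comm_monoid_VR[OF R])
  have "iso_class R (regular_rmodule R) [^]\<^bsub>VR R\<^esub> Suc n
      = iso_class R (free_rmodule R n) \<otimes>\<^bsub>VR R\<^esub> iso_class R (regular_rmodule R)"
    by (simp add: Suc)
  also have "\<dots> = iso_class R (free_rmodule R (Suc n))"
    by (simp add: VR_mult fg_projective_free fg_projective_regular fg_projective_direct_sum
        iso_class_eq_iff free_rmodule_Suc_iso R)
  finally show ?case .
qed

text \<open>
  The complement is found inside \<open>R\<^sup>n\<close>, as the kernel of the map sending the basis to generators of
  \<open>P\<close>.  Its carrier therefore has type \<^typ>\<open>nat \<Rightarrow> 'a\<close>, whatever the element type of \<open>P\<close>.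
\<close>

lemma fg_projective_complement:
  fixes R :: "('a, 'r) ring_scheme" and P :: "('a, 'm, 'x) rmodule_scheme"
  assumes P: "fg_projective R P"
  obtains n and Q :: "('a, nat \<Rightarrow> 'a) rmodule"
  where "fg_projective R Q" "rmod_iso R (direct_sum P Q) (free_rmodule R n)"
proof -
  have rP: "right_module R P" using P by (rule fg_projectiveD)
  interpret P: right_module R P by (rule rP)
  obtain n :: nat and x s where x: "x \<in> {..<n} \<rightarrow> carrier P"
    and s: "s \<in> rmod_hom R P (free_rmodule R n)"
    and xs: "\<And>p. p \<in> carrier P \<Longrightarrow> (\<Oplus>\<^bsub>P\<^esub>i\<in>{..<n}. x i \<triangleleft>\<^bsub>P\<^esub> s p i) = p"
    by (rule fg_projective_split[OF P]) (rule that)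
  define \<pi> where "\<pi> v = (\<Oplus>\<^bsub>P\<^esub>i\<in>{..<n}. x i \<triangleleft>\<^bsub>P\<^esub> v i)" for v
  have \<pi>: "\<pi> \<in> rmod_hom R (free_rmodule R n) P"
    unfolding \<pi>_def using rP x by (rule lincomb_hom)
  have F: "fg_projective R (free_rmodule R n)"
    by (rule fg_projective_free[OF P.R.ring_axioms])
  have "\<pi> (s p) = p" if "p \<in> carrier P" for p
    using xs[OF that] by (simp add: \<pi>_def)
  note split = split_surjection_kernel[OF F rP \<pi> s, OF this]
  show thesis by (rule that[OF split])
qed

section \<open>Injectivity for the submonoid generated by \<open>[R]\<close>\<close>

lemma UR_cofinal:
  fixes R :: "('a, 'r) ring_scheme"
  assumes R: "ring R" and X: "X \<in> carrier (VR R)"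
  shows "\<exists>Y\<in>carrier (VR R). \<exists>Z\<in>carrier (UR R). X \<otimes>\<^bsub>VR R\<^esub> Y = Z"
proof -
  obtain P :: "('a, nat \<Rightarrow> 'a) rmodule" where P: "fg_projective R P" "X = iso_class R P"
    by (rule VR_carrierE[OF X])
  obtain n and Q :: "('a, nat \<Rightarrow> 'a) rmodule"
    where Q: "fg_projective R Q" "rmod_iso R (direct_sum P Q) (free_rmodule R n)"
    by (rule fg_projective_complement[OF P(1)])
  have "X \<otimes>\<^bsub>VR R\<^esub> iso_class R Q = iso_class R (regular_rmodule R) [^]\<^bsub>VR R\<^esub> n"
    using P Q by (simp add: VR_mult VR_pow_regular[OF R] iso_class_eq_iff fg_projective_direct_sum)
  moreover have "iso_class R (regular_rmodule R) [^]\<^bsub>VR R\<^esub> n \<in> carrier (UR R)"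
    by (simp add: UR_def cyclic_submonoid_def)
  ultimately show ?thesis using iso_class_in_VR[OF Q(1)] by blast
qed

theorem proposition7:
  fixes R :: "('a, 'r) ring_scheme"
  assumes "ring R"
  shows "groth_map (UR R) (VR R) (\<lambda>x. x) \<in> mon (groth (UR R)) (K0 R)"
  unfolding K0_def
  using comm_monoid_UR[OF assms] comm_monoid_VR[OF assms]
  by (intro groth_map_mon_of_cofinal comm_monoid_is_comm_semigp UR_inclusion_hom UR_cofinal assms)
    auto

end
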